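(* No acute triangle admits a $k$-splitting reptiling for any $k\ge 3$.
   Context: An $r$-reptiling of a triangle $T$ ($r\ge 2$) is a subdivision of $T$ into $r$ triangles (tiles) with pairwise disjoint interiors, each similar to $T$ and all mutually congruent. For $k\ge2$, a $k$-splitting reptiling of $T$ is a reptiling in which exactly $k$ tiles meet at one of the vertices of $T$. A triangle is acute if all its angles are less than $\pi/2$. *)

theory Defs
  imports "HOL-Analysis.Analysis"
begin

text \<open>
  A triangle is a nondegenerate closed planar triangle, i.e. a set \<open>T :: (real^2) set\<close>
  with \<open>2 simplex T\<close>; its vertices are its extreme points.
\<close>

text \<open>The apex of the angle is the first argument.\<close>

definition angle_at :: "real^2 \<Rightarrow> real^2 \<Rightarrow> real^2 \<Rightarrow> real" where
  "angle_at a b c = arccos (((b - a) \<bullet> (c - a)) / (norm (b - a) * norm (c - a)))"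

definition acute_triangle :: "(real^2) set \<Rightarrow> bool" where
  "acute_triangle T \<longleftrightarrow> 2 simplex T \<and>
     (\<forall>a b c. a extreme_point_of T \<and> b extreme_point_of T \<and> c extreme_point_of T \<and>
        a \<noteq> b \<and> b \<noteq> c \<and> a \<noteq> c \<longrightarrow> angle_at a b c < pi / 2)"

text \<open>Similarity and congruence allow reflections.\<close>

definition similar_sets :: "(real^2) set \<Rightarrow> (real^2) set \<Rightarrow> bool" where
  "similar_sets S T \<longleftrightarrow>
     (\<exists>c f. c > 0 \<and> (\<forall>x y. dist (f x) (f y) = c * dist x y) \<and> f ` S = T)"

definition congruent_sets :: "(real^2) set \<Rightarrow> (real^2) set \<Rightarrow> bool" where
  "congruent_sets S T \<longleftrightarrow>
     (\<exists>f. (\<forall>x y. dist (f x) (f y) = dist x y) \<and> f ` S = T)"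

text \<open>The tiles need not meet edge to edge.\<close>

definition reptiling :: "nat \<Rightarrow> (real^2) set \<Rightarrow> (real^2) set set \<Rightarrow> bool" where
  "reptiling r T \<T> \<longleftrightarrow> r \<ge> 2 \<and> finite \<T> \<and> card \<T> = r \<and>
     (\<forall>S\<in>\<T>. 2 simplex S) \<and> \<Union>\<T> = T \<and>
     pairwise (\<lambda>S S'. interior S \<inter> interior S' = {}) \<T> \<and>
     (\<forall>S\<in>\<T>. similar_sets S T) \<and>
     (\<forall>S\<in>\<T>. \<forall>S'\<in>\<T>. congruent_sets S S')"

text \<open>
  A vertex \<open>v\<close> of \<open>T\<close> is an extreme point of every subset of \<open>T\<close> containing it, so the
  tiles meeting at \<open>v\<close> are exactly those that contain \<open>v\<close>.
\<close>

definition splitting_reptiling :: "nat \<Rightarrow> (real^2) set \<Rightarrow> (real^2) set set \<Rightarrow> bool" where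
  "splitting_reptiling k T \<T> \<longleftrightarrow> k \<ge> 2 \<and> (\<exists>r. reptiling r T \<T>) \<and>
     (\<exists>v. v extreme_point_of T \<and> card {S \<in> \<T>. v \<in> S} = k)"

end

theory Submission
  imports Defs "HOL-Computational_Algebra.Primes"
begin

text \<open>
  Let the tiles have angles \<open>x, y, z\<close>. Three or more angles adding up to an angle below \<open>\<pi>/2\<close>
  cannot be of two kinds, since two kinds together exceed \<open>\<pi>/2\<close>; so the split angle is
  \<open>z = k x\<close>, and \<open>y = \<pi> - (k + 1) x\<close>. With \<open>s = \<pi>/x\<close>, acuteness says \<open>2k < s < 2k + 2\<close>. If \<open>a, b, c\<close>
  tiles have their angles \<open>x, y, z\<close> at a point that is not a vertex of \<open>T\<close>, then
  \<open>a x + b y + c z \<in> {0, \<pi>, 2\<pi>}\<close>. For general \<open>s\<close> this forces \<open>c \<le> b\<close>, while at the vertices of \<open>T\<close> there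
  are more angles \<open>y\<close> than \<open>z\<close>; but in total all three kinds of angle occur equally often. For
  \<open>2s \<in> {4k + 1, 4k + 2, 4k + 3}\<close> another linear inequality between \<open>a, b, c\<close> does the same, except
  when \<open>k = 3\<close> and \<open>x = 2\<pi>/13\<close> or \<open>x = 2\<pi>/15\<close>, where angle counts are not contradictory.

  In these two cases let \<open>ZY\<close> be a side of \<open>T\<close> at the split vertex \<open>Z\<close>. It is a union of tile edges,
  and the edge at \<open>Z\<close> belongs to an angle \<open>x\<close>, so it is not opposite to \<open>x\<close>. Comparing areas, the
  scaling factor squared is the number \<open>r\<close> of tiles, so with \<open>u = 2 cos x\<close> and the law of sines
  \<open>(n\<^sub>1 + n\<^sub>2 (u\<^sup>3 - 2u) + n\<^sub>3 (u\<^sup>2 - 1))\<^sup>2 = r\<close> with natural numbers \<open>n\<^sub>2 + n\<^sub>3 > 0\<close>. Now \<open>u\<close> is quadratic over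
  a real subfield \<open>F\<close> (of degree 2 and 3, respectively); writing the bracket as \<open>P + Q u\<close> with
  \<open>P, Q \<in> F\<close>, the equation is linear in \<open>u\<close> after reduction and its leading coefficient is positive,
  so \<open>u \<in> F\<close>. This is false because the discriminant of \<open>u\<close> has a norm that is not a square.
\<close>

section \<open>Side relations for the angles \<open>2\<pi>/15\<close> and \<open>2\<pi>/13\<close>\<close>

text \<open>The multiplicity of \<open>p\<close> is even on the left, but odd on the right unless
  \<open>n = 0\<close>.\<close>

lemma int_square_eq_prime_mult_square:
  fixes m n :: int and p :: nat
  assumes "prime p" and eq: "m\<^sup>2 = int p * n\<^sup>2"
  shows "n = 0"
proof (rule ccontr)
  assume n: "n \<noteq> 0"
  have p: "prime (int p)" using assms(1) by simp
  then have p0: "int p \<noteq> 0" by auto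
  have m: "m \<noteq> 0" using eq n p0 by auto
  have "multiplicity (int p) (m\<^sup>2) = 2 * multiplicity (int p) m"
    using p m by (simp add: prime_elem_multiplicity_power_distrib)
  moreover have "multiplicity (int p) (int p * n\<^sup>2) = Suc (2 * multiplicity (int p) n)"
    using p n p0 by (subst multiplicity_times_same) (auto simp: prime_elem_multiplicity_power_distrib)
  ultimately have "2 * multiplicity (int p) m = Suc (2 * multiplicity (int p) n)"
    using eq by simp
  then show False by presburger
qed

text \<open>Reducing by the quadratic equation of \<open>u\<close> leaves \<open>V = U * u\<close>.
  Hence \<open>2 * V - g * U = U * (2 * u - g)\<close>, and \<open>2 * u - g\<close> squares to the
  discriminant. So unless \<open>U = 0\<close>, the discriminant is a square in the field generated
  by the coefficients.\<close>

lemma quadratic_eliminate: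
  fixes g h P Q r u :: real
  assumes u: "u\<^sup>2 = g * u - h" and r: "(P + Q * u)\<^sup>2 = r"
  defines "U \<equiv> 2 * P * Q + g * Q * Q" and "V \<equiv> r - P * P + h * Q * Q"
  shows "(2 * V - g * U)\<^sup>2 = U\<^sup>2 * (g\<^sup>2 - 4 * h)"
proof -
  have "P * P + 2 * P * Q * u + Q * Q * (g * u - h) = r"
    using r by (simp add: u[symmetric] power2_eq_square algebra_simps)
  then have "V = U * u" by (simp add: U_def V_def algebra_simps)
  then have "(2 * V - g * U)\<^sup>2 = U\<^sup>2 * (4 * u\<^sup>2 - 4 * g * u + g\<^sup>2)"
    by (simp add: power2_eq_square algebra_simps)
  then show ?thesis by (simp add: u)
qed

subsection \<open>The angle \<open>2\<pi>/15\<close>, over the golden field\<close>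

text \<open>The ring of integers of the golden field, since \<open>2 * cos (pi / 5)\<close> is the
  golden ratio.\<close>

definition golden_int :: "real \<Rightarrow> bool" where
  "golden_int w \<longleftrightarrow> (\<exists>a b :: int. w = real_of_int a + real_of_int b * (2 * cos (pi / 5)))"

text \<open>The cosines of 3 pi / 5 and 2 pi / 5 are opposite. Expanded in
  \<open>cos (pi / 5)\<close>, this is the desired quadratic equation times a positive
  factor.\<close>

lemma golden_square: "(2 * cos (pi / 5))\<^sup>2 = 2 * cos (pi / 5) + 1"
proof -
  define c where "c = cos (pi / 5)"
  have "c > 0" unfolding c_def by (rule cos_gt_zero) auto
  have "cos (3 * (pi / 5)) = - cos (pi - 3 * (pi / 5))" by (simp only: cos_pi_minus)
  also have "pi - 3 * (pi / 5) = 2 * (pi / 5)" by simp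
  finally have "cos (3 * (pi / 5)) = - cos (2 * (pi / 5))" .
  then have "4 * c ^ 3 - 3 * c = - (2 * c\<^sup>2 - 1)"
    by (simp only: c_def cos_treble_cos cos_double_cos)
  then have "(c + 1) * (4 * c\<^sup>2 - 2 * c - 1) = 0" by algebra
  with \<open>c > 0\<close> have "4 * c\<^sup>2 - 2 * c - 1 = 0" by auto
  then show ?thesis by (simp add: c_def[symmetric] power_mult_distrib)
qed

lemma golden_bounds: "1 < 2 * cos (pi / 5)" "2 * cos (pi / 5) < 2"
proof -
  have "cos (pi / 3) < cos (pi / 5)" by (rule cos_monotone_0_pi) auto
  then show "1 < 2 * cos (pi / 5)" by (simp add: cos_60)
  have "cos (pi / 5) < cos 0" by (rule cos_monotone_0_pi) auto
  then show "2 * cos (pi / 5) < 2" by simp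
qed

lemma golden_int_of_int: "golden_int (of_int a)"
  unfolding golden_int_def by (rule exI[of _ a], rule exI[of _ 0]) simp

lemma golden_int_of_nat: "golden_int (real n)"
  using golden_int_of_int[of "int n"] by simp

lemma golden_int_golden: "golden_int (2 * cos (pi / 5))"
  unfolding golden_int_def by (rule exI[of _ 0], rule exI[of _ 1]) simp

lemma golden_int_add: "golden_int v \<Longrightarrow> golden_int w \<Longrightarrow> golden_int (v + w)"
  unfolding golden_int_def
proof (elim exE)
  fix a b c d :: int
  assume "v = real_of_int a + real_of_int b * (2 * cos (pi / 5))" "w = c + d * (2 * cos (pi / 5))"
  then have "v + w = of_int (a + c) + of_int (b + d) * (2 * cos (pi / 5))" by (simp add: algebra_simps)
  then show "\<exists>a b :: int. v + w = real_of_int a + real_of_int b * (2 * cos (pi / 5))" by blast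
qed

lemma golden_int_mult: "golden_int v \<Longrightarrow> golden_int w \<Longrightarrow> golden_int (v * w)"
  unfolding golden_int_def
proof (elim exE)
  fix a b c d :: int
  define g where "g = 2 * cos (pi / 5)"
  assume "v = real_of_int a + real_of_int b * (2 * cos (pi / 5))" "w = c + d * (2 * cos (pi / 5))"
  moreover have "g\<^sup>2 = g + 1" using golden_square by (simp add: g_def)
  ultimately have "v * w = of_int (a * c + b * d) + of_int (a * d + b * c + b * d) * g"
    unfolding g_def[symmetric] of_int_add of_int_mult by algebra
  then show "\<exists>a b :: int. v * w = real_of_int a + real_of_int b * (2 * cos (pi / 5))" unfolding g_def by blast
qed

lemma golden_int_diff: "golden_int v \<Longrightarrow> golden_int w \<Longrightarrow> golden_int (v - w)"
  using golden_int_add[of v "of_int (-1) * w"] golden_int_mult[OF golden_int_of_int, of w "-1"] by simp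

lemmas golden_int_intros = golden_int_add golden_int_diff golden_int_mult
  golden_int_of_nat golden_int_golden

text \<open>Completing the square gives \<open>(2 * a + b)\<^sup>2 = 5 * b\<^sup>2\<close>, and 5 is
  prime.\<close>

lemma golden_basis:
  fixes a b :: int
  assumes "a + b * (2 * cos (pi / 5)) = 0"
  shows "a = 0 \<and> b = 0"
proof -
  define g where "g = 2 * cos (pi / 5)"
  have "g\<^sup>2 = g + 1" using golden_square by (simp add: g_def)
  moreover have ab: "real_of_int a + b * g = 0" using assms by (simp add: g_def)
  ultimately have "real_of_int (2 * a + b) ^ 2 = 5 * real_of_int b ^ 2"
    unfolding of_int_add of_int_mult of_int_numeral by algebra
  then have "real_of_int ((2 * a + b)\<^sup>2) = real_of_int (int 5 * b\<^sup>2)" by simp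
  then have "(2 * a + b)\<^sup>2 = int 5 * b\<^sup>2" by (simp only: of_int_eq_iff)
  then have "b = 0" by (rule int_square_eq_prime_mult_square[rotated]) simp
  with ab show ?thesis by simp
qed

lemma nine_minus_three_golden_not_square:
  assumes "golden_int U" "golden_int W"
    and eq: "W\<^sup>2 = U\<^sup>2 * (9 - 3 * (2 * cos (pi / 5)))"
  shows "U = 0"
proof -
  define g where "g = 2 * cos (pi / 5)"
  have g: "g\<^sup>2 = g + 1" using golden_square by (simp add: g_def)
  obtain a b :: int where U: "U = a + b * g" using assms(1) unfolding golden_int_def g_def by blast
  obtain c d :: int where W: "W = c + d * g" using assms(2) unfolding golden_int_def g_def by blast
  have "(c + d * g)\<^sup>2 = (a + b * g)\<^sup>2 * (9 - 3 * g)" using eq unfolding U W g_def .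
  then have "of_int (c\<^sup>2 + d\<^sup>2 - (9 * (a\<^sup>2 + b\<^sup>2) - 3 * (2 * a * b + b\<^sup>2)))
      + of_int (2 * c * d + d\<^sup>2 - (9 * (2 * a * b + b\<^sup>2) - 3 * (a\<^sup>2 + b\<^sup>2 + 2 * a * b + b\<^sup>2))) * g = 0"
    using g unfolding of_int_add of_int_diff of_int_mult of_int_power of_int_numeral by algebra
  from golden_basis[OF this[unfolded g_def]]
  have "c\<^sup>2 + d\<^sup>2 - (9 * (a\<^sup>2 + b\<^sup>2) - 3 * (2 * a * b + b\<^sup>2)) = 0"
    "2 * c * d + d\<^sup>2 - (9 * (2 * a * b + b\<^sup>2) - 3 * (a\<^sup>2 + b\<^sup>2 + 2 * a * b + b\<^sup>2)) = 0"
    by auto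
  \<comment> \<open>Norms are compared: \<open>a + b * g\<close> has norm
    \<open>a\<^sup>2 + a * b - b\<^sup>2\<close>, and \<open>9 - 3 * g\<close> has norm 45, which is
    5 times a square.\<close>
  then have "(c\<^sup>2 + c * d - d\<^sup>2)\<^sup>2 = int 5 * (3 * (a\<^sup>2 + a * b - b\<^sup>2))\<^sup>2"
    by simp algebra
  then have "3 * (a\<^sup>2 + a * b - b\<^sup>2) = 0" by (rule int_square_eq_prime_mult_square[rotated]) simp
  then have "(2 * a + b)\<^sup>2 = int 5 * b\<^sup>2" by simp algebra
  then have "b = 0" by (rule int_square_eq_prime_mult_square[rotated]) simp
  with \<open>3 * (a\<^sup>2 + a * b - b\<^sup>2) = 0\<close> show ?thesis by (simp add: U)
qed

lemma no_side_relation_15: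
  fixes n1 n2 n3 r :: nat and u :: real
  defines "u \<equiv> 2 * cos (2 * pi / 15)"
  assumes eq: "(n1 + n2 * (u ^ 3 - 2 * u) + n3 * (u\<^sup>2 - 1))\<^sup>2 = real r"
  shows "n2 = 0 \<and> n3 = 0"
proof (rule ccontr)
  assume nz: "\<not> (n2 = 0 \<and> n3 = 0)"
  define g where "g = 2 * cos (pi / 5)"
  have g: "g\<^sup>2 = g + 1" "1 < g" "g < 2" using golden_square golden_bounds by (simp_all add: g_def)
  \<comment> \<open>\<open>u'\<close> is the conjugate of \<open>u\<close> over the golden field:
    their sum and product lie in that field.\<close>
  define u' where "u' = 2 * cos (4 * (2 * pi / 15))"
  have "u + u' = 2 * (2 * cos ((2 * pi / 15 + 4 * (2 * pi / 15)) / 2) * cos ((2 * pi / 15 - 4 * (2 * pi / 15)) / 2))"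
    unfolding u_def u'_def cos_plus_cos[symmetric] by simp
  also have "(2 * pi / 15 + 4 * (2 * pi / 15)) / 2 = pi / 3" by simp
  also have "(2 * pi / 15 - 4 * (2 * pi / 15)) / 2 = - (pi / 5)" by simp
  finally have sum: "u + u' = g" by (simp add: cos_60 g_def)
  have "u * u' = 2 * (cos (2 * pi / 15 - 4 * (2 * pi / 15)) + cos (2 * pi / 15 + 4 * (2 * pi / 15)))"
    unfolding u_def u'_def by (simp add: cos_times_cos)
  also have "2 * pi / 15 - 4 * (2 * pi / 15) = - (2 * (pi / 5))" by simp
  also have "2 * pi / 15 + 4 * (2 * pi / 15) = 2 * pi / 3" by simp
  finally have "u * u' = 2 * cos (2 * (pi / 5)) - 1"
    by (simp add: cos_120)
  then have "u * u' = g\<^sup>2 - 3" by (simp only: cos_double_cos g_def power_mult_distrib) simp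
  with g sum have u2: "u\<^sup>2 = g * u - g + 2" by algebra
  \<comment> \<open>numerals are written \<open>real 1\<close>, \<open>real 2\<close> so that \<open>golden_int_of_nat\<close> applies\<close>
  define P where "P = real n1 + n2 * (g - real 1) + n3 * (real 1 - g)"
  define Q where "Q = real n2 + g * n3"
  \<comment> \<open>Modulo its quadratic equation, \<open>u ^ 3 - 2 * u\<close> is
    \<open>u + g - 1\<close>, and \<open>u\<^sup>2 - 1\<close> is
    \<open>g * u + 1 - g\<close>.\<close>
  have "real n1 + n2 * (u ^ 3 - 2 * u) + n3 * (u\<^sup>2 - 1) = P + Q * u"
    using u2 g(1) unfolding P_def Q_def of_nat_1 by algebra
  with eq have r: "(P + Q * u)\<^sup>2 = r" by simp
  define U where "U = real 2 * P * Q + g * Q * Q"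
  define V where "V = real r - P * P + (g - real 2) * Q * Q"
  define W where "W = real 2 * V - g * U"
  have "u\<^sup>2 = g * u - (g - 2)" using u2 by simp
  from quadratic_eliminate[OF this r] have "W\<^sup>2 = U\<^sup>2 * (9 - 3 * g)"
    by (simp add: W_def U_def V_def g(1))
  moreover have ints: "golden_int P" "golden_int Q"
    unfolding P_def Q_def g_def by (intro golden_int_intros)+
  have "golden_int U" "golden_int V"
    unfolding U_def V_def g_def by (intro golden_int_intros ints)+
  moreover from this have "golden_int W" unfolding W_def g_def by (intro golden_int_intros)
  ultimately have "U = 0" using nine_minus_three_golden_not_square unfolding g_def by blast
  \<comment> \<open>Since \<open>1 < g\<close> and \<open>g < 2\<close>, both factors are positive
    as soon as \<open>n2\<close> or \<open>n3\<close> is nonzero.\<close>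
  then have "(2 * P + g * Q) * Q = 0" by (simp add: U_def algebra_simps)
  moreover have "Q > 0" using nz g(2) unfolding Q_def by (cases "n2 = 0") (auto intro!: add_pos_nonneg)
  moreover have "2 * P + g * Q = 2 * n1 + n2 * (3 * g - 2) + n3 * (3 - g)"
    using g(1) unfolding P_def Q_def by simp algebra
  moreover have "2 * real n1 + n2 * (3 * g - 2) + n3 * (3 - g) > 0"
  proof (cases "n2 = 0")
    case True
    then show ?thesis using nz g by (intro add_nonneg_pos) auto
  next
    case False
    then show ?thesis using g by (intro add_nonneg_pos add_pos_nonneg) auto
  qed
  ultimately show False by auto
qed

subsection \<open>The angle \<open>2\<pi>/13\<close>, over the cubic field of Gaussian periods\<close>

text \<open>The norm form of \<open>a + b * e + c * e\<^sup>2\<close> for a root \<open>e\<close> of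
  the cubic \<open>t ^ 3 + t\<^sup>2 - 4 * t + 1\<close>.\<close>

definition period_norm :: "int \<Rightarrow> int \<Rightarrow> int \<Rightarrow> int" where
  "period_norm a b c = a^3 - a^2*b + 9*a^2*c - 4*a*b^2 + 14*a*c^2 - b^3 + b^2*c + 4*b*c^2 + c^3 + 7*a*b*c"

text \<open>The cubic has no root modulo 2, so 2 is inert in the cubic field and an even norm forces
  divisibility by 2. Concretely this is a check of parities.\<close>

lemma period_norm_even:
  assumes "even (period_norm a b c)"
  shows "even a \<and> even b \<and> even c"
proof -
  have "odd (9::int)" "odd (7::int)" "even (4::int)" "even (14::int)" by presburger+
  with assms show ?thesis unfolding period_norm_def
    by (simp only: even_add even_diff even_mult_iff even_power) (simp, blast)
qed

text \<open>Infinite descent: the form is odd unless all its arguments are even.\<close>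

lemma period_norm_eq_0:
  assumes "period_norm a b c = 0"
  shows "a = 0 \<and> b = 0 \<and> c = 0"
  using assms
proof (induction "nat (\<bar>a\<bar> + \<bar>b\<bar> + \<bar>c\<bar>)" arbitrary: a b c rule: less_induct)
  case less
  have "even a \<and> even b \<and> even c" by (rule period_norm_even) (simp add: less.prems)
  then obtain a' b' c' where abc: "a = 2 * a'" "b = 2 * b'" "c = 2 * c'" by (meson dvdE)
  have "8 * period_norm a' b' c' = period_norm a b c"
    unfolding abc period_norm_def by algebra
  then have z: "period_norm a' b' c' = 0" using less.prems by simp
  show ?case
  proof (cases "a = 0 \<and> b = 0 \<and> c = 0")
    case False
    then have "nat (\<bar>a'\<bar> + \<bar>b'\<bar> + \<bar>c'\<bar>) < nat (\<bar>a\<bar> + \<bar>b\<bar> + \<bar>c\<bar>)" using abc by auto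
    from less.hyps[OF this z] show ?thesis using abc by auto
  qed
qed

text \<open>The relations between the three Gaussian periods, each a sum of four primitive 13th
  roots of unity. They fix the elementary symmetric functions, so no cosines appear in the
  arithmetic.\<close>

locale cubic_periods =
  fixes e1 e2 e3 :: real
  assumes e12: "e1 * e2 = e1 - 1" and e23: "e2 * e3 = e2 - 1" and e31: "e3 * e1 = e3 - 1"
    and e_sum: "e1 + e2 + e3 = -1"
begin

lemma e123: "e1 * e2 * e3 = -1"
proof -
  have "e1 * e2 * e3 = e3 * e1 - e3" unfolding e12 by (simp add: algebra_simps)
  then show ?thesis using e31 by simp
qed

lemma e_pairs: "e1 * e2 + e2 * e3 + e3 * e1 = -4"
  using e12 e23 e31 e_sum by linarith

text \<open>The product is symmetric in the periods, hence a polynomial in the values given by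
  \<open>e_sum\<close>, \<open>e_pairs\<close> and \<open>e123\<close>.\<close>

lemma period_norm:
  fixes a b c :: int
  shows "(a + b * e1 + c * e1\<^sup>2) * (a + b * e2 + c * e2\<^sup>2) * (a + b * e3 + c * e3\<^sup>2)
    = period_norm a b c"
  using e_sum e_pairs e123
  unfolding period_norm_def of_int_add of_int_diff of_int_mult of_int_power of_int_numeral
  by algebra

text \<open>A linear relation yields an element of norm 0, and the norm form has no nontrivial
  zero.\<close>

lemma basis:
  fixes a b c :: int
  assumes "a + b * e1 + c * e1\<^sup>2 = 0"
  shows "a = 0 \<and> b = 0 \<and> c = 0"
proof -
  have "real_of_int (period_norm a b c) = 0" using period_norm[of a b c] assms by simp
  then show ?thesis by (intro period_norm_eq_0) simp
qed

lemma cubic: "e1 ^ 3 + e1\<^sup>2 - 4 * e1 + 1 = 0" "e2 ^ 3 + e2\<^sup>2 - 4 * e2 + 1 = 0"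
  "e3 ^ 3 + e3\<^sup>2 - 4 * e3 + 1 = 0"
proof -
  have "t ^ 3 + t\<^sup>2 - 4 * t + 1 = (t - e1) * (t - e2) * (t - e3)" for t
  proof -
    have "(t - e1) * (t - e2) * (t - e3)
        = t ^ 3 - (e1 + e2 + e3) * t\<^sup>2 + (e1 * e2 + e2 * e3 + e3 * e1) * t - e1 * e2 * e3"
      by algebra
    then show ?thesis unfolding e_sum e_pairs e123 by simp
  qed
  then show "e1 ^ 3 + e1\<^sup>2 - 4 * e1 + 1 = 0" "e2 ^ 3 + e2\<^sup>2 - 4 * e2 + 1 = 0"
    "e3 ^ 3 + e3\<^sup>2 - 4 * e3 + 1 = 0" by simp_all
qed

text \<open>The cubic field is Galois. This matters because \<open>e2\<close> is the constant term
  of the quadratic equation of \<open>2 * cos (2 * pi / 13)\<close>.\<close>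

lemma e2_eq: "e2 = e1\<^sup>2 + e1 - 3"
proof -
  have "e1 \<noteq> 0" using e12 by auto
  moreover have "e1 * e2 = e1 * (e1\<^sup>2 + e1 - 3)" using cubic(1) e12 by algebra
  ultimately show ?thesis by simp
qed

definition period_int :: "real \<Rightarrow> bool" where
  "period_int w \<longleftrightarrow> (\<exists>a b c :: int. w = real_of_int a + real_of_int b * e1 + real_of_int c * e1\<^sup>2)"

lemma period_int_of_int: "period_int (of_int a)"
  unfolding period_int_def by (rule exI[of _ a], rule exI[of _ 0], rule exI[of _ 0]) simp

lemma period_int_of_nat: "period_int (real n)"
  using period_int_of_int[of "int n"] by simp

lemma period_int_e1: "period_int e1"
  unfolding period_int_def by (rule exI[of _ 0], rule exI[of _ 1], rule exI[of _ 0]) simp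

lemma period_int_add: "period_int v \<Longrightarrow> period_int w \<Longrightarrow> period_int (v + w)"
  unfolding period_int_def
proof (elim exE)
  fix a b c a' b' c' :: int
  assume "v = a + b * e1 + c * e1\<^sup>2" "w = a' + b' * e1 + c' * e1\<^sup>2"
  then have "v + w = of_int (a + a') + of_int (b + b') * e1 + of_int (c + c') * e1\<^sup>2"
    by (simp add: algebra_simps)
  then show "\<exists>a b c :: int. v + w = real_of_int a + real_of_int b * e1 + real_of_int c * e1\<^sup>2" by blast
qed

lemma period_int_mult: "period_int v \<Longrightarrow> period_int w \<Longrightarrow> period_int (v * w)"
  unfolding period_int_def
proof (elim exE)
  fix a b c a' b' c' :: int
  assume "v = a + b * e1 + c * e1\<^sup>2" "w = a' + b' * e1 + c' * e1\<^sup>2"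
  \<comment> \<open>The coefficients come from \<open>e1 ^ 3 = 4 * e1 - e1\<^sup>2 - 1\<close> and
    \<open>e1 ^ 4 = 5 * e1\<^sup>2 - 5 * e1 + 1\<close>.\<close>
  then have "v * w = of_int (a * a' - (b * c' + c * b') + c * c')
      + of_int (a * b' + b * a' + 4 * (b * c' + c * b') - 5 * (c * c')) * e1
      + of_int (a * c' + b * b' + c * a' - (b * c' + c * b') + 5 * (c * c')) * e1\<^sup>2"
    using cubic(1) unfolding of_int_add of_int_diff of_int_mult of_int_numeral by algebra
  then show "\<exists>a b c :: int. v * w = real_of_int a + real_of_int b * e1 + real_of_int c * e1\<^sup>2" by blast
qed

lemma period_int_diff: "period_int v \<Longrightarrow> period_int w \<Longrightarrow> period_int (v - w)"
  using period_int_add[of v "of_int (-1) * w"] period_int_mult[OF period_int_of_int, of w "-1"] by simp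

lemmas period_int_intros = period_int_add period_int_diff period_int_mult
  period_int_of_nat period_int_e1

text \<open>\<open>12 - 4e - 3e\<^sup>2\<close> has norm \<open>13\<close>, which is not a square.\<close>

lemma disc_not_square:
  assumes "period_int U" "period_int W" and eq: "W\<^sup>2 = U\<^sup>2 * (12 - 4 * e1 - 3 * e1\<^sup>2)"
  shows "U = 0"
proof -
  obtain a b c :: int where U: "U = a + b * e1 + c * e1\<^sup>2"
    using assms(1) unfolding period_int_def by blast
  obtain p q s :: int where W: "W = p + q * e1 + s * e1\<^sup>2"
    using assms(2) unfolding period_int_def by blast
  \<comment> \<open>The \<open>s0\<close>, \<open>s1\<close>, \<open>s2\<close> are the coefficients
    of the square of \<open>U\<close> reduced by the cubic; \<open>g0\<close>, \<open>g1\<close>,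
    \<open>g2\<close> are those of the difference of the two sides.\<close>
  define s0 s1 s2 where "s0 = a\<^sup>2 - 2 * b * c + c\<^sup>2" and "s1 = 2 * a * b + 8 * b * c - 5 * c\<^sup>2"
    and "s2 = b\<^sup>2 + 2 * a * c - 2 * b * c + 5 * c\<^sup>2"
  define g0 g1 g2 where "g0 = p\<^sup>2 - 2 * q * s + s\<^sup>2 - (12 * s0 + 3 * s1 + s2)"
    and "g1 = 2 * p * q + 8 * q * s - 5 * s\<^sup>2 - (- 4 * s0 - s2)"
    and "g2 = q\<^sup>2 + 2 * p * s - 2 * q * s + 5 * s\<^sup>2 - (- 3 * s0 - s1 + s2)"
  have red: "(p + q * t + s * t\<^sup>2)\<^sup>2 - (a + b * t + c * t\<^sup>2)\<^sup>2 * (12 - 4 * t - 3 * t\<^sup>2)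
      = g0 + g1 * t + g2 * t\<^sup>2" if "t ^ 3 + t\<^sup>2 - 4 * t + 1 = 0" for t :: real
    using that unfolding g0_def g1_def g2_def s0_def s1_def s2_def
      of_int_add of_int_diff of_int_mult of_int_power of_int_numeral of_int_minus
    by algebra
  have "g0 = 0 \<and> g1 = 0 \<and> g2 = 0"
    using basis[of g0 g1 g2] red[OF cubic(1)] eq unfolding U W by simp
  \<comment> \<open>The reduction rests on the cubic equation alone, which all three periods
    satisfy. So the relation passes to the conjugates, and the product of its three instances
    compares norms.\<close>
  then have conj: "(p + q * t + s * t\<^sup>2)\<^sup>2 = (a + b * t + c * t\<^sup>2)\<^sup>2 * (12 - 4 * t - 3 * t\<^sup>2)"
    if "t ^ 3 + t\<^sup>2 - 4 * t + 1 = 0" for t :: real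
    using red[OF that] by simp
  have norm: "(12 - 4 * e1 - 3 * e1\<^sup>2) * (12 - 4 * e2 - 3 * e2\<^sup>2) * (12 - 4 * e3 - 3 * e3\<^sup>2) = 13"
    using period_norm[of 12 "-4" "-3"] by (simp add: period_norm_def)
  have "real_of_int (period_norm p q s) ^ 2 = 13 * real_of_int (period_norm a b c) ^ 2"
    unfolding period_norm[symmetric]
    using conj[OF cubic(1)] conj[OF cubic(2)] conj[OF cubic(3)] norm
    by (simp add: power_mult_distrib)
  then have "real_of_int ((period_norm p q s)\<^sup>2) = real_of_int (int 13 * (period_norm a b c)\<^sup>2)" by simp
  then have "(period_norm p q s)\<^sup>2 = int 13 * (period_norm a b c)\<^sup>2" by (simp only: of_int_eq_iff)
  then have "period_norm a b c = 0" by (rule int_square_eq_prime_mult_square[rotated]) simp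
  from period_norm_eq_0[OF this] show ?thesis by (simp add: U)
qed

end

section \<open>Cosines of the multiples of \<open>2 * pi / 13\<close>\<close>

lemma cos_mult_13:
  fixes i j :: nat
  defines "C \<equiv> \<lambda>k. 2 * cos (real k * (2 * pi / 13))"
  assumes "i + j = 13"
  shows "C i = C j"
proof -
  have "real i = 13 - real j" using assms(2) by linarith
  then have "real i * (2 * pi / 13) = 2 * pi - real j * (2 * pi / 13)"
    by (simp add: left_diff_distrib)
  then show ?thesis by (simp only: C_def cos_diff cos_two_pi sin_two_pi) simp
qed

lemma cos_2pi_13_periods:
  defines "C \<equiv> \<lambda>k::nat. 2 * cos (real k * (2 * pi / 13))"
  shows "cubic_periods (C 1 + C 5) (C 4 + C 6) (C 2 + C 3)"
    and "C 1 * C 5 = C 4 + C 6" and "0 < C 1 + C 5" and "C 1 + C 5 < 1"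
proof -
  have mult: "C i * C j = C (i + j) + C (i - j)" if "j \<le> i" for i j
    using that by (simp only: C_def of_nat_add of_nat_diff distrib_right left_diff_distrib cos_add cos_diff) simp
  have refl: "C 7 = C 6" "C 8 = C 5" "C 9 = C 4" "C 10 = C 3" "C 11 = C 2" "C 12 = C 1"
    unfolding C_def by (rule cos_mult_13; simp)+
  \<comment> \<open>Products become sums of two values; indices above 6 are folded back by
    \<open>C i = C (13 - i)\<close>.\<close>
  have m: "C 4 * C 1 = C 5 + C 3" "C 6 * C 1 = C 6 + C 5" "C 5 * C 4 = C 4 + C 1" "C 6 * C 5 = C 2 + C 1"
    "C 4 * C 2 = C 6 + C 2" "C 4 * C 3 = C 6 + C 1" "C 6 * C 2 = C 5 + C 4" "C 6 * C 3 = C 4 + C 3"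
    "C 2 * C 1 = C 3 + C 1" "C 3 * C 1 = C 4 + C 2" "C 5 * C 2 = C 6 + C 3" "C 5 * C 3 = C 5 + C 2"
    "C 5 * C 1 = C 6 + C 4" "C 1 * C 1 = C 2 + 2"
    "C 3 * C 2 = C 5 + C 1" "C 6 * C 4 = C 3 + C 2"
    using mult[of 1 4] mult[of 1 6] mult[of 4 5] mult[of 5 6]  mult[of 2 4] mult[of 3 4] mult[of 2 6] mult[of 3 6]
       mult[of 1 2] mult[of 1 3]  mult[of 2 5] mult[of 3 5] mult[of 1 5] mult[of 1 1] mult[of 2 3] mult[of 4 6] refl
    by (auto simp: C_def)
  \<comment> \<open>The 13th roots of unity add up to 0: multiplication by \<open>C 1 - 2\<close>
    telescopes, and this factor is nonzero.\<close>
  have "(C 1 - 2) * (C 1 + C 2 + C 3 + C 4 + C 5 + C 6 + 1) = 0"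
    using m by algebra
  moreover have "C 1 < 2"
    unfolding C_def using cos_monotone_0_pi[of 0 "2 * pi / 13"] by simp
  ultimately have sum: "C 1 + C 2 + C 3 + C 4 + C 5 + C 6 = -1" by auto
  show "cubic_periods (C 1 + C 5) (C 4 + C 6) (C 2 + C 3)"
    by unfold_locales (use m sum in algebra)+
  show "C 1 * C 5 = C 4 + C 6" using m by algebra
  have "C 1 + C 5 = 2 * (2 * cos ((1 * (2 * pi / 13) + 5 * (2 * pi / 13)) / 2)
      * cos ((1 * (2 * pi / 13) - 5 * (2 * pi / 13)) / 2))"
    unfolding C_def cos_plus_cos[symmetric] by simp
  also have "(1 * (2 * pi / 13) + 5 * (2 * pi / 13)) / 2 = 6 * pi / 13" by simp
  also have "(1 * (2 * pi / 13) - 5 * (2 * pi / 13)) / 2 = - (4 * pi / 13)" by simp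
  finally have e: "C 1 + C 5 = 4 * (cos (6 * pi / 13) * cos (4 * pi / 13))" by simp
  have pos: "0 < cos (6 * pi / 13)" "0 < cos (4 * pi / 13)" by (rule cos_gt_zero; simp)+
  then show "0 < C 1 + C 5" unfolding e by simp
  \<comment> \<open>The angle is close to \<open>pi / 2\<close>, so its cosine is small enough to
    push the product below 1/4.\<close>
  have "cos (6 * pi / 13) = sin (pi / 2 - 6 * pi / 13)" by (simp only: sin_diff) simp
  also have "pi / 2 - 6 * pi / 13 = pi / 26" by simp
  also have "sin (pi / 26) \<le> pi / 26" by (rule sin_x_le_x) simp
  also have "pi / 26 < 1 / 4" using pi_less_4 by simp
  finally have "cos (6 * pi / 13) * cos (4 * pi / 13) < 1 / 4 * 1"
    using pos cos_le_one by (intro mult_less_le_imp_less) auto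
  then show "C 1 + C 5 < 1" unfolding e by simp
qed

lemma no_side_relation_13:
  fixes n1 n2 n3 r :: nat and u :: real
  defines "u \<equiv> 2 * cos (2 * pi / 13)"
  assumes eq: "(n1 + n2 * (u ^ 3 - 2 * u) + n3 * (u\<^sup>2 - 1))\<^sup>2 = real r"
  shows "n2 = 0 \<and> n3 = 0"
proof (rule ccontr)
  assume nz: "\<not> (n2 = 0 \<and> n3 = 0)"
  define C where "C = (\<lambda>k::nat. 2 * cos (real k * (2 * pi / 13)))"
  define e1 e2 e3 where "e1 = C 1 + C 5" and "e2 = C 4 + C 6" and "e3 = C 2 + C 3"
  interpret cubic_periods e1 e2 e3
    unfolding e1_def e2_def e3_def C_def by (rule cos_2pi_13_periods)
  have u: "u = C 1" by (simp add: u_def C_def)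
  have e: "0 < e1" "e1 < 1" using cos_2pi_13_periods by (simp_all add: e1_def C_def)
  have "C 1 * C 5 = e2" using cos_2pi_13_periods by (simp add: e2_def C_def)
  \<comment> \<open>\<open>C 1\<close> and \<open>C 5\<close> are conjugate over the cubic field,
    with sum \<open>e1\<close> and product \<open>e2\<close>.\<close>
  then have u2: "u\<^sup>2 = e1 * u - e2" by (simp add: e1_def u power2_eq_square algebra_simps)
  define P where "P = real n1 + n2 * (real 1 - e1) + n3 * (real 2 - e1 * e1 - e1)"
  define Q where "Q = n2 * (real 1 - e1) + n3 * e1"
  \<comment> \<open>Here \<open>u ^ 3 - 2 * u\<close> reduces to \<open>(1 - e1) * (u + 1)\<close>,
    and \<open>u\<^sup>2 - 1\<close> to \<open>e1 * u + 2 - e1 * e1 - e1\<close>.\<close>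
  have "real n1 + n2 * (u ^ 3 - 2 * u) + n3 * (u\<^sup>2 - 1) = P + Q * u"
    using u2 e2_eq cubic(1) unfolding P_def Q_def of_nat_1 of_nat_numeral by algebra
  with eq have r: "(P + Q * u)\<^sup>2 = r" by simp
  define U where "U = real 2 * P * Q + e1 * Q * Q"
  define V where "V = real r - P * P + (e1 * e1 + e1 - real 3) * Q * Q"
  define W where "W = real 2 * V - e1 * U"
  have "W\<^sup>2 = U\<^sup>2 * (12 - 4 * e1 - 3 * e1\<^sup>2)"
    using quadratic_eliminate[OF u2 r]
    by (simp add: W_def U_def V_def e2_eq power2_eq_square algebra_simps)
  moreover have ints: "period_int P" "period_int Q"
    unfolding P_def Q_def by (intro period_int_intros)+
  have "period_int U" "period_int V"
    unfolding U_def V_def by (intro period_int_intros ints)+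
  moreover from this have "period_int W" unfolding W_def by (intro period_int_intros)
  ultimately have "U = 0" using disc_not_square by blast
  then have "(2 * P + e1 * Q) * Q = 0" by (simp add: U_def algebra_simps)
  moreover have "Q > 0" using nz e unfolding Q_def
    by (cases "n2 = 0") (auto intro!: add_pos_nonneg)
  moreover have "P \<ge> 0"
  proof -
    have "e1 * e1 \<le> 1 * 1" using e by (intro mult_mono) auto
    then show ?thesis using e unfolding P_def by auto
  qed
  moreover have "2 * P + e1 * Q > 0"
    using \<open>Q > 0\<close> \<open>P \<ge> 0\<close> e by (intro add_nonneg_pos) auto
  ultimately show False by auto
qed

section \<open>Angles as measures of directions\<close>

definition cross2 :: "real^2 \<Rightarrow> real^2 \<Rightarrow> real" where
  "cross2 u v = u$1 * v$2 - u$2 * v$1"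

definition direction :: "real \<Rightarrow> real^2" where
  "direction t = vector [cos t, sin t]"

lemma direction_nth [simp]: "direction t $ 1 = cos t" "direction t $ 2 = sin t"
  by (simp_all add: direction_def)

lemma inner_real2: "(u::real^2) \<bullet> v = u$1 * v$1 + u$2 * v$2"
  by (simp add: inner_vec_def sum_2)

lemma norm_real2: "(norm (u::real^2))\<^sup>2 = (u$1)\<^sup>2 + (u$2)\<^sup>2"
  by (simp only: power2_norm_eq_inner inner_real2) (simp add: power2_eq_square)

lemma eq_real2: "u = (v::real^2) \<longleftrightarrow> u$1 = v$1 \<and> u$2 = v$2"
  by (simp add: vec_eq_iff forall_2)

lemma cross2_simps:
  "cross2 (u + v) w = cross2 u w + cross2 v w" "cross2 u (v + w) = cross2 u v + cross2 u w"
  "cross2 (u - v) w = cross2 u w - cross2 v w" "cross2 u (v - w) = cross2 u v - cross2 u w"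
  "cross2 (c *\<^sub>R u) v = c * cross2 u v" "cross2 u (c *\<^sub>R v) = c * cross2 u v"
  by (simp_all add: cross2_def algebra_simps)

lemma cross2_swap: "cross2 u v = - cross2 v u"
  by (simp add: cross2_def)

lemma cross2_square: "(cross2 u v)\<^sup>2 = (norm u)\<^sup>2 * (norm v)\<^sup>2 - (u \<bullet> v)\<^sup>2"
  by (simp only: norm_real2 inner_real2 cross2_def) algebra

lemma polar:
  assumes "u \<noteq> 0"
  obtains t where "0 \<le> t" "t < 2 * pi" "u = norm u *\<^sub>R direction t"
proof -
  have n: "norm u > 0" using assms by simp
  have "(u$1 / norm u)\<^sup>2 + (u$2 / norm u)\<^sup>2 = 1"
    using n by (simp add: power_divide add_divide_distrib[symmetric] norm_real2[symmetric])
  then obtain t where t: "0 \<le> t" "t < 2 * pi" "u$1 / norm u = cos t" "u$2 / norm u = sin t"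
    by (rule sincos_total_2pi)
  have "norm u * cos t = u$1" "norm u * sin t = u$2" unfolding t(3,4)[symmetric] using n by simp_all
  then have "u = norm u *\<^sub>R direction t" unfolding eq_real2 by simp
  with t that show thesis by blast
qed

lemma cross2_direction: "cross2 (direction s) (direction t) = sin (t - s)"
  by (simp add: cross2_def sin_diff algebra_simps)

text \<open>Shifting the part before \<open>c\<close> by a full turn carries one window to the
  other. A sector can then be measured in a window that starts at one of its rays, where it does not
  wrap round.\<close>

lemma measure_periodic_window:
  fixes E :: "real set"
  assumes per: "\<And>t. t + 2 * pi \<in> E \<longleftrightarrow> t \<in> E" and c: "0 \<le> c" "c < 2 * pi"
    and E: "E \<inter> {c..<c + 2 * pi} \<in> lmeasurable"
  shows "E \<inter> {0..<2 * pi} \<in> lmeasurable"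
    and "measure lebesgue (E \<inter> {0..<2 * pi}) = measure lebesgue (E \<inter> {c..<c + 2 * pi})"
proof -
  define L H where "L = E \<inter> {0..<c}" and "H = E \<inter> {c..<2 * pi}"
  have H: "H = (E \<inter> {c..<c + 2 * pi}) \<inter> {c..<2 * pi}" using c by (auto simp: H_def)
  have shift: "(+) (2 * pi) ` L = (E \<inter> {c..<c + 2 * pi}) \<inter> {2 * pi..<c + 2 * pi}" (is "_ = ?R")
  proof (intro equalityI subsetI)
    fix t assume "t \<in> (+) (2 * pi) ` L"
    then obtain s where "s \<in> E" "0 \<le> s" "s < c" "t = s + 2 * pi" by (auto simp: L_def)
    then show "t \<in> ?R" using per[of s] c by auto
  next
    fix t assume t: "t \<in> ?R"
    then have "t - 2 * pi \<in> L" using per[of "t - 2 * pi"] by (auto simp: L_def)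
    then show "t \<in> (+) (2 * pi) ` L" by (force intro: image_eqI[where x = "t - 2 * pi"])
  qed
  have mH: "H \<in> lmeasurable" unfolding H by (rule fmeasurable_Int_fmeasurable[OF E]) auto
  have mL': "(+) (2 * pi) ` L \<in> lmeasurable"
    unfolding shift by (rule fmeasurable_Int_fmeasurable[OF E]) auto
  then have mL: "L \<in> lmeasurable"
    using measurable_translation[of _ "- (2 * pi)"] by (fastforce simp: image_image)
  have A: "E \<inter> {0..<2 * pi} = L \<union> H" using c by (auto simp: L_def H_def)
  have B: "E \<inter> {c..<c + 2 * pi} = (+) (2 * pi) ` L \<union> H" unfolding shift using c by (auto simp: H_def)
  show "E \<inter> {0..<2 * pi} \<in> lmeasurable" unfolding A using mL mH by auto
  have "measure lebesgue (L \<union> H) = measure lebesgue L + measure lebesgue H"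
    using mL mH by (intro measure_Un2[THEN trans] ) (auto simp: L_def H_def intro!: arg_cong[where f = "measure lebesgue"])
  moreover have "measure lebesgue ((+) (2 * pi) ` L \<union> H)
      = measure lebesgue ((+) (2 * pi) ` L) + measure lebesgue H"
    using mL' mH unfolding shift
    by (intro measure_Un2[THEN trans] ) (auto simp: H_def intro!: arg_cong[where f = "measure lebesgue"])
  ultimately show "measure lebesgue (E \<inter> {0..<2 * pi}) = measure lebesgue (E \<inter> {c..<c + 2 * pi})"
    unfolding A B by (simp add: measure_translation)
qed

lemma direction_periodic [simp]: "direction (t + 2 * pi) = direction t"
  by (simp add: direction_def)

text \<open>By \<open>cross2_square\<close> the two quotients satisfy the Pythagorean identity, and
  a nonzero cross product keeps \<open>arccos\<close> away from 0 and pi.\<close>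

lemma angle_at_cos_sin:
  assumes D: "cross2 (B - A) (C - A) \<noteq> 0"
  shows "cos (angle_at A B C) = ((B - A) \<bullet> (C - A)) / (norm (B - A) * norm (C - A))"
    and "sin (angle_at A B C) = \<bar>cross2 (B - A) (C - A)\<bar> / (norm (B - A) * norm (C - A))"
    and "0 < angle_at A B C" "angle_at A B C < pi"
proof -
  define u v where "u = B - A" and "v = C - A"
  have D': "cross2 u v \<noteq> 0" using D by (simp add: u_def v_def)
  then have "u \<noteq> 0" "v \<noteq> 0" by (auto simp: cross2_def)
  then have n: "norm u * norm v > 0" by simp
  have sq: "((u \<bullet> v) / (norm u * norm v))\<^sup>2 = 1 - (\<bar>cross2 u v\<bar> / (norm u * norm v))\<^sup>2"
    using \<open>u \<noteq> 0\<close> \<open>v \<noteq> 0\<close>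
    by (simp add: power_divide power_mult_distrib cross2_square diff_divide_distrib)
  have pos: "\<bar>cross2 u v\<bar> / (norm u * norm v) > 0" using n D' by simp
  have "((u \<bullet> v) / (norm u * norm v))\<^sup>2 < 1"
    using zero_less_power[OF pos, of 2] sq by linarith
  then have bd: "\<bar>(u \<bullet> v) / (norm u * norm v)\<bar> < 1" by (simp add: abs_square_less_1)
  have ang: "angle_at A B C = arccos ((u \<bullet> v) / (norm u * norm v))"
    by (simp add: angle_at_def u_def v_def)
  show "cos (angle_at A B C) = ((B - A) \<bullet> (C - A)) / (norm (B - A) * norm (C - A))"
    using cos_arccos_abs[OF less_imp_le[OF bd]] ang unfolding u_def v_def by simp
  show "sin (angle_at A B C) = \<bar>cross2 (B - A) (C - A)\<bar> / (norm (B - A) * norm (C - A))"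
    using bd pos sq ang by (simp add: sin_arccos_abs u_def[symmetric] v_def[symmetric])
  show "0 < angle_at A B C" "angle_at A B C < pi"
    unfolding ang using arccos_lt_bounded[of "(u \<bullet> v) / (norm u * norm v)"] bd
    unfolding abs_less_iff by linarith+
qed

text \<open>The identities \<open>c2\<close> and \<open>d2\<close> between the inner products at the
  three vertices give \<open>cos (x + y) = cos (pi - z)\<close>. As \<open>sin (x + y) > 0\<close>,
  both arguments lie where the cosine is injective.\<close>

lemma angle_sum:
  assumes D: "cross2 (B - A) (C - A) \<noteq> 0"
  shows "angle_at A B C + angle_at B C A + angle_at C A B = pi"
proof -
  define x y z where "x = angle_at A B C" and "y = angle_at B C A" and "z = angle_at C A B"
  define p q r where "p = (B - A) \<bullet> (C - A)" and "q = (C - B) \<bullet> (A - B)" and "r = (A - C) \<bullet> (B - C)"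
  define a b c where "a = norm (B - C)" and "b = norm (C - A)" and "c = norm (A - B)"
  define d where "d = \<bar>cross2 (B - A) (C - A)\<bar>"
  have cr: "cross2 (C - B) (A - B) = cross2 (B - A) (C - A)"
    "cross2 (A - C) (B - C) = cross2 (B - A) (C - A)"
    by (simp_all add: cross2_def algebra_simps)
  have X: "cos x = p / (c * b)" "sin x = d / (c * b)" "0 < x" "x < pi"
    using angle_at_cos_sin[OF D] by (simp_all add: x_def p_def d_def b_def c_def norm_minus_commute)
  have Y: "cos y = q / (a * c)" "sin y = d / (a * c)" "0 < y" "y < pi"
    using angle_at_cos_sin[of C B A] D unfolding cr
    by (simp_all add: y_def q_def d_def a_def c_def norm_minus_commute)
  have Z: "cos z = r / (a * b)" "sin z = d / (a * b)" "0 < z" "z < pi"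
    using angle_at_cos_sin[of A C B] D unfolding cr
    by (simp_all add: z_def r_def d_def a_def b_def norm_minus_commute mult.commute)
  have ne: "A \<noteq> B" "B \<noteq> C" "A \<noteq> C" using D by (auto simp: cross2_def)
  then have pos: "a > 0" "b > 0" "c > 0" "d > 0" using D by (simp_all add: a_def b_def c_def d_def)
  have c2: "c\<^sup>2 = p + q"
    unfolding c_def p_def q_def norm_real2 inner_real2 by (simp add: power2_eq_square algebra_simps)
  have d2: "d\<^sup>2 = p * q + q * r + r * p"
    unfolding d_def p_def q_def r_def power2_abs inner_real2 cross2_def vector_minus_component by algebra
  have "cos (x + y) = (p * q - d\<^sup>2) / (a * b * c\<^sup>2)"
    using pos unfolding cos_add X Y by (simp add: field_simps power2_eq_square)
  also have "\<dots> = - (r * c\<^sup>2) / (a * b * c\<^sup>2)" unfolding c2 d2 by (simp add: algebra_simps)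
  also have "\<dots> = cos (pi - z)" using pos by (simp add: Z)
  finally have cos_eq: "cos (x + y) = cos (pi - z)" .
  have "sin (x + y) = d * (p + q) / (a * b * c\<^sup>2)"
    using pos unfolding sin_add X Y by (simp add: field_simps power2_eq_square)
  then have "sin (x + y) > 0" using pos unfolding c2[symmetric] by simp
  then have "x + y < pi"
    using X(3,4) Y(3,4) sin_le_zero[of "x + y"] by linarith
  then have "x + y = pi - z"
    using X(3) Y(3) Z(3,4) by (intro cos_inj_pi[OF _ _ _ _ cos_eq]) auto
  then show ?thesis by (simp add: x_def y_def z_def)
qed

lemma measure_sector:
  assumes D: "cross2 (B - A) (C - A) > 0"
  defines "E \<equiv> {t. cross2 (B - A) (direction t) \<ge> 0 \<and> cross2 (direction t) (C - A) \<ge> 0}"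
  shows "E \<inter> {0..<2 * pi} \<in> lmeasurable"
    and "measure lebesgue (E \<inter> {0..<2 * pi}) = angle_at A B C"
proof -
  define u v f where "u = B - A" and "v = C - A" and "f = angle_at A B C"
  have nz: "u \<noteq> 0" "v \<noteq> 0" using D by (auto simp: cross2_def u_def v_def)
  obtain s where s: "0 \<le> s" "s < 2 * pi" and u: "u = norm u *\<^sub>R direction s"
    using polar[OF nz(1)] by blast
  have f: "cos f = (u \<bullet> v) / (norm u * norm v)" "sin f = cross2 u v / (norm u * norm v)" "0 < f" "f < pi"
    using angle_at_cos_sin[of B A C] D by (simp_all add: f_def u_def v_def)
  \<comment> \<open>Turning the direction of \<open>u\<close> by \<open>f\<close> gives that of
    \<open>v\<close>; the positive cross product fixes the sense of rotation.\<close>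
  have v: "v = norm v *\<^sub>R direction (s + f)"
  proof -
    have *: "norm v * cos f = direction s \<bullet> v" "norm v * sin f = cross2 (direction s) v"
      using nz unfolding f by (subst u; simp add: cross2_simps)+
    have "norm v * cos (s + f) = cos s * (norm v * cos f) - sin s * (norm v * sin f)"
      "norm v * sin (s + f) = sin s * (norm v * cos f) + cos s * (norm v * sin f)"
      by (simp_all add: cos_add sin_add algebra_simps)
    then have "norm v * cos (s + f) = ((cos s)\<^sup>2 + (sin s)\<^sup>2) * v$1"
      "norm v * sin (s + f) = ((cos s)\<^sup>2 + (sin s)\<^sup>2) * v$2"
      unfolding * inner_real2 cross2_def direction_nth by algebra+
    then show ?thesis by (simp add: eq_real2)
  qed
  have mem: "t \<in> E \<longleftrightarrow> sin (t - s) \<ge> 0 \<and> sin (s + f - t) \<ge> 0" for t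
  proof -
    have "cross2 u (direction t) = norm u * sin (t - s)"
      by (subst u) (simp add: cross2_simps cross2_direction)
    moreover have "cross2 (direction t) v = norm v * sin (s + f - t)"
      by (subst v) (simp add: cross2_simps cross2_direction)
    ultimately show ?thesis
      using nz by (simp add: E_def u_def[symmetric] v_def[symmetric] zero_le_mult_iff)
  qed
  \<comment> \<open>In the window that begins at the ray of \<open>u\<close>, the sector is a single
    interval of length \<open>f\<close>.\<close>
  have "E \<inter> {s..<s + 2 * pi} = {s..s + f}"
  proof (intro equalityI subsetI)
    fix t assume t: "t \<in> E \<inter> {s..<s + 2 * pi}"
    have "t - s \<le> pi"
    proof (rule ccontr)
      assume "\<not> t - s \<le> pi"
      then have "sin (t - s) < 0" using t by (intro sin_lt_zero) auto
      then show False using t mem by auto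
    qed
    moreover have "t \<le> s + f"
    proof (rule ccontr)
      assume "\<not> t \<le> s + f"
      then have "sin (t - (s + f)) > 0" using f \<open>t - s \<le> pi\<close> by (intro sin_gt_zero) auto
      then show False using t mem[of t] sin_minus[of "t - (s + f)"] by auto
    qed
    ultimately show "t \<in> {s..s + f}" using t by auto
  next
    fix t assume t: "t \<in> {s..s + f}"
    then have "sin (t - s) \<ge> 0" "sin (s + f - t) \<ge> 0" using f by (auto intro!: sin_ge_zero)
    then show "t \<in> E \<inter> {s..<s + 2 * pi}" using mem t f by auto
  qed
  moreover have "t + 2 * pi \<in> E \<longleftrightarrow> t \<in> E" for t by (simp add: E_def)
  ultimately show "E \<inter> {0..<2 * pi} \<in> lmeasurable"
    "measure lebesgue (E \<inter> {0..<2 * pi}) = angle_at A B C"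
    using measure_periodic_window[of E s] s f by (simp_all add: f_def)
qed

lemma measure_half_plane:
  assumes "w \<noteq> 0"
  defines "E \<equiv> {t. cross2 (direction t) w \<ge> 0}"
  shows "E \<inter> {0..<2 * pi} \<in> lmeasurable"
    and "measure lebesgue (E \<inter> {0..<2 * pi}) = pi"
proof -
  obtain s where s: "0 \<le> s" "s < 2 * pi" and w: "w = norm w *\<^sub>R direction s"
    using polar[OF assms(1)] by blast
  have mem: "t \<in> E \<longleftrightarrow> sin (t - s) \<le> 0" for t
  proof -
    have "cross2 (direction t) w = - norm w * sin (t - s)"
      by (subst w) (simp add: cross2_simps cross2_direction sin_diff algebra_simps)
    then show ?thesis using assms(1) by (simp add: E_def mult_le_0_iff)
  qed
  \<comment> \<open>Seen from the direction of \<open>w\<close>, the half plane is half a turn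
    together with the isolated boundary direction \<open>s\<close>.\<close>
  have "E \<inter> {s..<s + 2 * pi} = {s} \<union> {s + pi..<s + 2 * pi}"
  proof (intro equalityI subsetI)
    fix t assume t: "t \<in> E \<inter> {s..<s + 2 * pi}"
    show "t \<in> {s} \<union> {s + pi..<s + 2 * pi}"
    proof (rule ccontr)
      assume "t \<notin> {s} \<union> {s + pi..<s + 2 * pi}"
      then have "sin (t - s) > 0" using t by (intro sin_gt_zero) auto
      then show False using t mem by auto
    qed
  next
    fix t assume t: "t \<in> {s} \<union> {s + pi..<s + 2 * pi}"
    have "sin (t - s) \<le> 0"
    proof (cases "t = s")
      case False
      then show ?thesis using t by (intro sin_le_zero) auto
    qed simp
    then show "t \<in> E \<inter> {s..<s + 2 * pi}" using mem t pi_gt_zero by auto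
  qed
  moreover have "measure lebesgue ({s} \<union> {s + pi..<s + 2 * pi}) = pi"
    by (subst Un_commute, subst measure_Un_null_set) auto
  moreover have "{s} \<union> {s + pi..<s + 2 * pi} \<in> lmeasurable" by (intro fmeasurable.Un bounded_set_imp_lmeasurable) auto
  moreover have "t + 2 * pi \<in> E \<longleftrightarrow> t \<in> E" for t by (simp add: E_def)
  ultimately show "E \<inter> {0..<2 * pi} \<in> lmeasurable"
    "measure lebesgue (E \<inter> {0..<2 * pi}) = pi"
    using measure_periodic_window[of E s] s by simp_all
qed

section \<open>Barycentric coordinates as ratios of signed areas\<close>

definition bary :: "real^2 \<Rightarrow> real^2 \<Rightarrow> real^2 \<Rightarrow> real^2 \<Rightarrow> real" where
  "bary A B C P = cross2 (B - P) (C - P) / cross2 (B - A) (C - A)"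

lemma cross2_rotate: "cross2 (C - B) (A - B) = cross2 (B - A) (C - A)"
  by (simp add: cross2_def algebra_simps)

lemma bary_sum:
  assumes "cross2 (B - A) (C - A) \<noteq> 0"
  shows "bary A B C P + bary B C A P + bary C A B P = 1"
proof -
  have "bary A B C P + bary B C A P + bary C A B P
    = (cross2 (B - P) (C - P) + cross2 (C - P) (A - P) + cross2 (A - P) (B - P)) / cross2 (B - A) (C - A)"
    by (simp add: bary_def cross2_rotate[of C B A] cross2_rotate[of A C B] add_divide_distrib)
  also have "cross2 (B - P) (C - P) + cross2 (C - P) (A - P) + cross2 (A - P) (B - P) = cross2 (B - A) (C - A)"
    by (simp add: cross2_def algebra_simps)
  finally show ?thesis using assms by simp
qed

lemma bary_combination:
  assumes "cross2 (B - A) (C - A) \<noteq> 0"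
  shows "P = bary A B C P *\<^sub>R A + bary B C A P *\<^sub>R B + bary C A B P *\<^sub>R C"
proof -
  have "cross2 (B - A) (C - A) *\<^sub>R P =
    cross2 (B - P) (C - P) *\<^sub>R A + cross2 (C - P) (A - P) *\<^sub>R B + cross2 (A - P) (B - P) *\<^sub>R C"
    by (simp add: eq_real2 cross2_def) algebra
  also have "\<dots> = cross2 (B - A) (C - A) *\<^sub>R
      (bary A B C P *\<^sub>R A + bary B C A P *\<^sub>R B + bary C A B P *\<^sub>R C)"
    using assms by (simp add: bary_def cross2_rotate[of C B A] cross2_rotate[of A C B] scaleR_right_distrib)
  finally show ?thesis using assms by simp
qed

lemma bary_affine:
  assumes "u + v + w = 1"
  shows "bary A B C (u *\<^sub>R X + v *\<^sub>R Y + w *\<^sub>R Z) = u * bary A B C X + v * bary A B C Y + w * bary A B C Z"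
proof -
  have w: "w = 1 - u - v" using assms by simp
  show ?thesis
    unfolding w bary_def times_divide_eq_right add_divide_distrib[symmetric]
    by (rule arg_cong[where f = "\<lambda>x. x / _"]) (simp add: cross2_def, algebra)
qed

lemma bary_vertex:
  assumes "cross2 (B - A) (C - A) \<noteq> 0"
  shows "bary A B C A = 1" "bary A B C B = 0" "bary A B C C = 0"
  using assms by (simp_all add: bary_def) (simp_all add: cross2_def)

lemma triangle_iff:
  assumes D: "cross2 (B - A) (C - A) \<noteq> 0"
  shows "P \<in> convex hull {A, B, C} \<longleftrightarrow> 0 \<le> bary A B C P \<and> 0 \<le> bary B C A P \<and> 0 \<le> bary C A B P"
proof
  have D': "cross2 (C - B) (A - B) \<noteq> 0" "cross2 (A - C) (B - C) \<noteq> 0"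
    using D cross2_rotate[of C B A] cross2_rotate[of A C B] by simp_all
  assume "P \<in> convex hull {A, B, C}"
  then obtain u v w where "0 \<le> u" "0 \<le> v" "0 \<le> w" "u + v + w = 1" "P = u *\<^sub>R A + v *\<^sub>R B + w *\<^sub>R C"
    unfolding convex_hull_3 by blast
  then show "0 \<le> bary A B C P \<and> 0 \<le> bary B C A P \<and> 0 \<le> bary C A B P"
    using bary_vertex[OF D] bary_vertex[OF D'(1)] bary_vertex[OF D'(2)] by (simp add: bary_affine)
next
  assume "0 \<le> bary A B C P \<and> 0 \<le> bary B C A P \<and> 0 \<le> bary C A B P"
  then show "P \<in> convex hull {A, B, C}"
    unfolding convex_hull_3 using bary_sum[OF D, of P] bary_combination[OF D, of P] by blast
qed

lemma bary_move: "bary A B C (P + e *\<^sub>R d) = bary A B C P + e * (cross2 d (B - C) / cross2 (B - A) (C - A))"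
proof -
  have "cross2 (B - (P + e *\<^sub>R d)) (C - (P + e *\<^sub>R d)) = cross2 (B - P) (C - P) + e * cross2 d (B - C)"
    by (simp add: cross2_def algebra_simps)
  then show ?thesis by (simp add: bary_def add_divide_distrib)
qed

section \<open>Inward directions and the aperture of a triangle at a point\<close>

text \<open>The sets \<open>S\<close> of interest are convex, so a single \<open>e > 0\<close> yields all smaller ones.\<close>

definition inward :: "real^2 \<Rightarrow> (real^2) set \<Rightarrow> real set" where
  "inward P S = {t. P \<in> S \<and> (\<exists>e>0. P + e *\<^sub>R direction t \<in> S)}"

text \<open>Measuring directions makes sense at every point and adds up over a tiling, whether or
  not the tiles meet edge to edge.\<close>

definition aperture :: "real^2 \<Rightarrow> (real^2) set \<Rightarrow> real" where
  "aperture P S = measure lebesgue (inward P S \<inter> {0..<2 * pi})"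

text \<open>Barycentric coordinates are affine along a ray. Those positive at \<open>P\<close> stay
  positive for a short while, so only the vanishing ones constrain the direction.\<close>

lemma inward_triangle:
  assumes D: "cross2 (B - A) (C - A) \<noteq> 0" and P: "P \<in> convex hull {A, B, C}"
  shows "t \<in> inward P (convex hull {A, B, C}) \<longleftrightarrow>
    (bary A B C P = 0 \<longrightarrow> 0 \<le> cross2 (direction t) (B - C) / cross2 (B - A) (C - A)) \<and>
    (bary B C A P = 0 \<longrightarrow> 0 \<le> cross2 (direction t) (C - A) / cross2 (B - A) (C - A)) \<and>
    (bary C A B P = 0 \<longrightarrow> 0 \<le> cross2 (direction t) (A - B) / cross2 (B - A) (C - A))"
    (is "?L \<longleftrightarrow> ?R")
proof
  note rot = cross2_rotate[of C B A] cross2_rotate[of A C B]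
  assume ?L
  then obtain e where "e > 0" "P + e *\<^sub>R direction t \<in> convex hull {A, B, C}" unfolding inward_def by blast
  then have "0 \<le> bary A B C P + e * (cross2 (direction t) (B - C) / cross2 (B - A) (C - A))"
    "0 \<le> bary B C A P + e * (cross2 (direction t) (C - A) / cross2 (B - A) (C - A))"
    "0 \<le> bary C A B P + e * (cross2 (direction t) (A - B) / cross2 (B - A) (C - A))"
    unfolding triangle_iff[OF D] bary_move rot by auto
  moreover have "0 \<le> l" if "0 \<le> b + e * l" "b = 0" for b l
    using that \<open>e > 0\<close> by (simp add: zero_le_mult_iff)
  ultimately show ?R by blast
next
  note rot = cross2_rotate[of C B A] cross2_rotate[of A C B]
  assume R: ?R
  have small: "\<forall>\<^sub>F e in at_right 0. 0 \<le> b + e * l" if "0 \<le> b" "b = 0 \<longrightarrow> 0 \<le> l" for b l :: real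
  proof (cases "b = 0")
    case True
    then show ?thesis using that eventually_at_right_less[of "0::real"]
      by (auto elim!: eventually_mono)
  next
    case False
    have "((\<lambda>e. b + e * l) \<longlongrightarrow> b + 0 * l) (at_right 0)" by (intro tendsto_intros)
    then have "\<forall>\<^sub>F e in at_right 0. 0 < b + e * l" using that False by (intro order_tendstoD) auto
    then show ?thesis by (auto elim: eventually_mono)
  qed
  have "\<forall>\<^sub>F e in at_right 0. e > 0 \<and> P + e *\<^sub>R direction t \<in> convex hull {A, B, C}"
    unfolding triangle_iff[OF D] bary_move rot
    using P R unfolding triangle_iff[OF D]
    by (intro eventually_conj eventually_at_right_less small) blast+
  then have "\<exists>e>0. P + e *\<^sub>R direction t \<in> convex hull {A, B, C}"
    using eventually_happens'[of "at_right (0::real)"] by (auto simp: trivial_limit_at_right_real)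
  then show ?L using P by (simp add: inward_def)
qed

lemma aperture_vertex:
  assumes D: "cross2 (B - A) (C - A) \<noteq> 0"
  shows "inward A (convex hull {A, B, C}) \<inter> {0..<2 * pi} \<in> lmeasurable"
    and "aperture A (convex hull {A, B, C}) = angle_at A B C"
proof -
  have A: "A \<in> convex hull {A, B, C}" by (simp add: hull_inc)
  have b: "bary A B C A \<noteq> 0" "bary B C A A = 0" "bary C A B A = 0"
    using D by (simp_all add: bary_def) (simp_all add: cross2_def)
  have *: "cross2 d (A - B) = cross2 (B - A) d" for d by (simp add: cross2_def algebra_simps)
  have "inward A (convex hull {A, B, C}) \<inter> {0..<2 * pi} \<in> lmeasurable \<and>
    aperture A (convex hull {A, B, C}) = angle_at A B C"
  proof (cases "cross2 (B - A) (C - A) > 0")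
    case True
    then have "inward A (convex hull {A, B, C}) =
      {t. cross2 (B - A) (direction t) \<ge> 0 \<and> cross2 (direction t) (C - A) \<ge> 0}"
      using inward_triangle[OF D A] b * by (auto simp: zero_le_divide_iff)
    then show ?thesis using measure_sector[OF True] by (simp add: aperture_def)
  next
    \<comment> \<open>In the negative orientation, exchanging \<open>B\<close> and \<open>C\<close>
      leads back to the same sector computation.\<close>
    case False
    then have pos: "cross2 (C - A) (B - A) > 0" using D cross2_swap[of "B - A"] by simp
    have "0 \<le> x / cross2 (B - A) (C - A) \<longleftrightarrow> x \<le> 0" for x
      using False D by (auto simp: zero_le_divide_iff)
    moreover have "cross2 d (C - A) \<le> 0 \<longleftrightarrow> cross2 (C - A) d \<ge> 0"
      "cross2 d (A - B) \<le> 0 \<longleftrightarrow> cross2 d (B - A) \<ge> 0" for d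
      by (auto simp: cross2_def algebra_simps)
    ultimately have "inward A (convex hull {A, B, C}) =
      {t. cross2 (C - A) (direction t) \<ge> 0 \<and> cross2 (direction t) (B - A) \<ge> 0}"
      using inward_triangle[OF D A] b by blast
    moreover have "angle_at A C B = angle_at A B C"
      by (simp add: angle_at_def inner_commute mult.commute)
    ultimately show ?thesis using measure_sector[OF pos] by (simp add: aperture_def)
  qed
  then show "inward A (convex hull {A, B, C}) \<inter> {0..<2 * pi} \<in> lmeasurable"
    "aperture A (convex hull {A, B, C}) = angle_at A B C" by auto
qed

lemma aperture_edge:
  assumes D: "cross2 (B - A) (C - A) \<noteq> 0" and P: "P \<in> convex hull {A, B, C}"
    and b: "bary A B C P = 0" "bary B C A P \<noteq> 0" "bary C A B P \<noteq> 0"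
  shows "inward P (convex hull {A, B, C}) \<inter> {0..<2 * pi} \<in> lmeasurable"
    and "aperture P (convex hull {A, B, C}) = pi"
proof -
  define w where "w = (1 / cross2 (B - A) (C - A)) *\<^sub>R (B - C)"
  have "B \<noteq> C" using D by (auto simp: cross2_def)
  then have w: "w \<noteq> 0" using D by (simp add: w_def)
  have "inward P (convex hull {A, B, C}) = {t. cross2 (direction t) w \<ge> 0}"
    using inward_triangle[OF D P] b by (auto simp: w_def cross2_simps)
  then show "inward P (convex hull {A, B, C}) \<inter> {0..<2 * pi} \<in> lmeasurable"
    "aperture P (convex hull {A, B, C}) = pi"
    using measure_half_plane[OF w] by (simp_all add: aperture_def)
qed

lemma aperture_interior:
  assumes D: "cross2 (B - A) (C - A) \<noteq> 0" and P: "P \<in> convex hull {A, B, C}"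
    and b: "bary A B C P \<noteq> 0" "bary B C A P \<noteq> 0" "bary C A B P \<noteq> 0"
  shows "inward P (convex hull {A, B, C}) \<inter> {0..<2 * pi} \<in> lmeasurable"
    and "aperture P (convex hull {A, B, C}) = 2 * pi"
proof -
  have "inward P (convex hull {A, B, C}) = UNIV" using inward_triangle[OF D P] b by auto
  then show "inward P (convex hull {A, B, C}) \<inter> {0..<2 * pi} \<in> lmeasurable"
    "aperture P (convex hull {A, B, C}) = 2 * pi"
    by (auto simp: aperture_def intro!: bounded_set_imp_lmeasurable)
qed

text \<open>\<open>h\<close> counts half turns: 0 outside the triangle and at its vertices, 1 inside
  an edge, 2 in the interior.\<close>

lemma aperture_triangle:
  assumes D: "cross2 (B - A) (C - A) \<noteq> 0"
  shows "inward P (convex hull {A, B, C}) \<inter> {0..<2 * pi} \<in> lmeasurable \<and>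
    (\<exists>h::nat. h \<le> 2 \<and> (P \<in> {A, B, C} \<longrightarrow> h = 0) \<and> (P \<in> convex hull {A, B, C} - {A, B, C} \<longrightarrow> Suc 0 \<le> h) \<and>
    aperture P (convex hull {A, B, C}) = (if P = A then angle_at A B C else 0)
      + (if P = B then angle_at B C A else 0) + (if P = C then angle_at C A B else 0) + pi * h)"
    (is "?M P \<and> (\<exists>h. ?O P h)")
proof -
  have D': "cross2 (C - B) (A - B) \<noteq> 0" "cross2 (A - C) (B - C) \<noteq> 0"
    using D cross2_rotate[of C B A] cross2_rotate[of A C B] by simp_all
  have ne: "A \<noteq> B" "B \<noteq> C" "A \<noteq> C" using D by (auto simp: cross2_def)
  have rot: "{B, C, A} = {A, B, C}" "{C, A, B} = {A, B, C}" by auto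
  note V = aperture_vertex[OF D] aperture_vertex[OF D'(1), unfolded rot] aperture_vertex[OF D'(2), unfolded rot]
  note E = aperture_edge[OF D] aperture_edge[OF D'(1), unfolded rot] aperture_edge[OF D'(2), unfolded rot]
  note comb = bary_combination[OF D, of P] and bsum = bary_sum[OF D, of P]
  have zero: "bary A B C A = 1" "bary A B C B = 0" "bary A B C C = 0"
     "bary B C A A = 0" "bary B C A B = 1" "bary B C A C = 0"
     "bary C A B A = 0" "bary C A B B = 0" "bary C A B C = 1"
    using bary_vertex[OF D] bary_vertex[OF D'(1)] bary_vertex[OF D'(2)] by simp_all
  consider "P \<notin> convex hull {A, B, C}" | "P \<in> {A, B, C}"
    | "P \<in> convex hull {A, B, C}" "P \<notin> {A, B, C}"
    by blast
  then show ?thesis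
  proof cases
    case 1
    then have "P \<notin> {A, B, C}" using hull_inc[of P "{A, B, C}" convex] by blast
    moreover have "inward P (convex hull {A, B, C}) = {}" using 1 by (simp add: inward_def)
    ultimately show ?thesis using 1 by (auto simp: aperture_def intro!: exI[of _ 0])
  next
    case 2
    then show ?thesis using V ne by (auto intro!: exI[of _ 0])
  next
    case 3
    consider "bary A B C P \<noteq> 0" "bary B C A P \<noteq> 0" "bary C A B P \<noteq> 0"
      | "bary A B C P = 0" "bary B C A P \<noteq> 0" "bary C A B P \<noteq> 0"
      | "bary A B C P \<noteq> 0" "bary B C A P = 0" "bary C A B P \<noteq> 0"
      | "bary A B C P \<noteq> 0" "bary B C A P \<noteq> 0" "bary C A B P = 0"
      using 3(2) comb bsum by force
    then show ?thesis
    proof cases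
      case 1
      from aperture_interior[OF D 3(1) 1] show ?thesis using 3 by (auto intro!: exI[of _ 2])
    next
      case 2
      from E(1,2)[OF 3(1) 2] show ?thesis using 3 by (auto intro!: exI[of _ 1])
    next
      case c: 3
      from E(3,4)[OF 3(1) c(2,3,1)] show ?thesis using 3 by (auto intro!: exI[of _ 1])
    next
      case 4
      from E(5,6)[OF 3(1) 4(3,1,2)] show ?thesis using 3 by (auto intro!: exI[of _ 1])
    qed
  qed
qed

section \<open>Additivity of the aperture over a tiling\<close>

lemma inward_Union:
  assumes fin: "finite \<T>" and cl: "\<And>S. S \<in> \<T> \<Longrightarrow> closed S" and cv: "convex (\<Union>\<T>)"
  shows "inward P (\<Union>\<T>) = (\<Union>S\<in>\<T>. inward P S)"
proof
  show "(\<Union>S\<in>\<T>. inward P S) \<subseteq> inward P (\<Union>\<T>)" unfolding inward_def by blast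
  show "inward P (\<Union>\<T>) \<subseteq> (\<Union>S\<in>\<T>. inward P S)"
  proof
    fix t assume "t \<in> inward P (\<Union>\<T>)"
    then obtain e where e: "e > 0" "P \<in> \<Union>\<T>" "P + e *\<^sub>R direction t \<in> \<Union>\<T>" unfolding inward_def by blast
    define x where "x n = P + (e / Suc n) *\<^sub>R direction t" for n
    have xT: "x n \<in> \<Union>\<T>" for n
    proof -
      have "x n = (1 - 1 / Suc n) *\<^sub>R P + (1 / Suc n) *\<^sub>R (P + e *\<^sub>R direction t)"
        by (simp add: x_def algebra_simps)
      then show ?thesis using convexD[OF cv e(2,3), of "1 - 1 / Suc n" "1 / Suc n"] by simp
    qed
    \<comment> \<open>As there are finitely many tiles, one contains infinitely many of the points
      \<open>x n\<close>; being closed, it contains their limit \<open>P\<close>.\<close>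
    have "\<exists>S\<in>\<T>. \<exists>\<^sub>F n in sequentially. x n \<in> S"
    proof (rule ccontr)
      assume "\<not> ?thesis"
      then have "\<forall>S\<in>\<T>. \<forall>\<^sub>F n in sequentially. x n \<notin> S" by (simp add: frequently_def)
      then have "\<forall>\<^sub>F n in sequentially. \<forall>S\<in>\<T>. x n \<notin> S" by (rule eventually_ball_finite[OF fin])
      then obtain n where "\<forall>S\<in>\<T>. x n \<notin> S" unfolding eventually_sequentially by blast
      then show False using xT by blast
    qed
    then obtain S where S: "S \<in> \<T>" "\<exists>\<^sub>F n in sequentially. x n \<in> S" by blast
    have "(\<lambda>n. e / real (Suc n)) \<longlonglongrightarrow> 0"
      using tendsto_mult_right_zero[OF LIMSEQ_inverse_real_of_nat, of e] by (simp add: divide_inverse)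
    then have "x \<longlonglongrightarrow> P + 0 *\<^sub>R direction t" unfolding x_def by (intro tendsto_intros)
    then have lim: "x \<longlonglongrightarrow> P" by simp
    have "P \<in> S"
    proof (rule ccontr)
      assume "P \<notin> S"
      then have "\<forall>\<^sub>F n in sequentially. x n \<in> - S"
        using cl[OF S(1)] by (intro topological_tendstoD[OF lim]) auto
      then show False using S(2) by (simp add: frequently_def)
    qed
    moreover obtain n where "x n \<in> S" using frequently_ex[OF S(2)] by blast
    moreover have "e / Suc n > 0" using e by simp
    ultimately have "t \<in> inward P S" unfolding inward_def x_def by blast
    then show "t \<in> (\<Union>S\<in>\<T>. inward P S)" using S by blast
  qed
qed

text \<open>The common part is convex without interior, so it lies on a line. Directions inward for
  both sets are parallel to this line, and only countably many parameters give such
  directions.\<close>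

lemma negligible_inward_Int:
  assumes cv: "convex S" "convex S'" and int: "interior S \<inter> interior S' = {}"
  shows "negligible (inward P S \<inter> inward P S')"
proof -
  have "convex (S \<inter> S')" "interior (S \<inter> S') = {}" using cv int by (auto intro: convex_Int)
  then obtain a b where a: "a \<noteq> 0" and sub: "S \<inter> S' \<subseteq> {x. a \<bullet> x = b}"
    by (rule empty_interior_subset_hyperplane)
  obtain s where s: "a = norm a *\<^sub>R direction s" using polar[OF a] by blast
  have "inward P S \<inter> inward P S' \<subseteq> range (\<lambda>n::int. s + pi / 2 + of_int n * pi)"
  proof
    fix t assume "t \<in> inward P S \<inter> inward P S'"
    then obtain d e where de: "P \<in> S" "P \<in> S'" "d > 0" "e > 0"
      "P + d *\<^sub>R direction t \<in> S" "P + e *\<^sub>R direction t \<in> S'"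
      unfolding inward_def by blast
    define m where "m = min d e"
    have seg: "P + m *\<^sub>R direction t \<in> R" if "convex R" "P \<in> R" "P + c *\<^sub>R direction t \<in> R" "m \<le> c" for R c
    proof -
      have "m > 0" "c > 0" using de that by (auto simp: m_def)
      then have "P + m *\<^sub>R direction t = (1 - m / c) *\<^sub>R P + (m / c) *\<^sub>R (P + c *\<^sub>R direction t)"
        by (simp add: algebra_simps)
      then show ?thesis using convexD[OF that(1-3), of "1 - m / c" "m / c"] \<open>m > 0\<close> \<open>c > 0\<close> that(4) by simp
    qed
    have "P + m *\<^sub>R direction t \<in> S \<inter> S'" using seg de cv by (auto simp: m_def)
    then have "a \<bullet> (P + m *\<^sub>R direction t) = b" using sub by blast
    moreover have "a \<bullet> P = b" using sub de by blast
    moreover have "m > 0" using de by (simp add: m_def)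
    ultimately have "a \<bullet> direction t = 0" by (simp add: inner_add_right)
    then have "norm a * cos (t - s) = 0"
      by (subst (asm) s) (simp add: inner_real2 cos_diff algebra_simps)
    then have "cos (t - s) = 0" using a by simp
    then obtain n :: int where "t - s = of_int n * pi + pi / 2"
      unfolding cos_zero_iff_int2 by blast
    then show "t \<in> range (\<lambda>n::int. s + pi / 2 + of_int n * pi)" by (auto simp: algebra_simps)
  qed
  moreover have "negligible (range (\<lambda>n::int. s + pi / 2 + of_int n * pi))"
    unfolding negligible_iff_null_sets
    by (intro null_sets_completionI countable_imp_null_set_lborel) simp
  ultimately show ?thesis by (rule negligible_subset[rotated])
qed

lemma aperture_Union:
  assumes fin: "finite \<T>" and cl: "\<And>S. S \<in> \<T> \<Longrightarrow> closed S" and cvS: "\<And>S. S \<in> \<T> \<Longrightarrow> convex S"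
    and cv: "convex (\<Union>\<T>)" and int: "pairwise (\<lambda>S S'. interior S \<inter> interior S' = {}) \<T>"
    and meas: "\<And>S. S \<in> \<T> \<Longrightarrow> inward P S \<inter> {0..<2 * pi} \<in> lmeasurable"
  shows "aperture P (\<Union>\<T>) = (\<Sum>S\<in>\<T>. aperture P S)"
proof -
  have eq: "inward P (\<Union>\<T>) \<inter> {0..<2 * pi} = (\<Union>S\<in>\<T>. inward P S \<inter> {0..<2 * pi})"
    using inward_Union[OF fin cl cv] by auto
  have "pairwise (\<lambda>S S'. negligible ((inward P S \<inter> {0..<2 * pi}) \<inter> (inward P S' \<inter> {0..<2 * pi}))) \<T>"
  proof (rule pairwiseI)
    fix S S' assume "S \<in> \<T>" "S' \<in> \<T>" "S \<noteq> S'"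
    then have "negligible (inward P S \<inter> inward P S')"
      using int cvS by (intro negligible_inward_Int) (auto simp: pairwise_def)
    then show "negligible ((inward P S \<inter> {0..<2 * pi}) \<inter> (inward P S' \<inter> {0..<2 * pi}))"
      by (rule negligible_subset) auto
  qed
  then show ?thesis unfolding aperture_def eq
    by (intro measure_negligible_finite_Union_image fin meas)
qed

section \<open>Angle counts at a point\<close>

text \<open>In units of \<open>x\<close> the angles are 1, \<open>s - (k + 1)\<close> and
  \<open>k\<close>, and pi is \<open>s\<close>. If \<open>c > b\<close>, the difference
  \<open>M - b\<close> decides: 0 forces \<open>k <= b\<close>, 1 makes \<open>s\<close> an integer,
  2 makes \<open>2 * s\<close> an integer, and negative values contradict
  \<open>s > 6\<close>.\<close>

lemma vertex_counts_dominance: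
  fixes a b c k M :: nat and s :: real
  assumes k: "k \<ge> 3" and s: "2 * k < s" "s < 2 * k + 2" and M: "M \<le> 2"
    and eq: "a + b * (s - (k + 1)) + c * k = M * s"
  shows "c \<le> b \<or> s = 2 * k + 1 \<or> 2 * s = 4 * k + 1 \<or> 2 * s = 4 * k + 3"
proof (rule ccontr)
  assume "\<not> ?thesis"
  then have cb: "b + 1 \<le> c" and s1: "s \<noteq> 2 * k + 1" "2 * s \<noteq> 4 * k + 1" "2 * s \<noteq> 4 * k + 3" by auto
  have eq': "(real M - real b) * s = real a + real c * real k - real b * (real k + 1)"
    using eq by (simp add: algebra_simps)
  have ck: "(b + 1) * k \<le> c * k" using cb by (rule mult_le_mono1)
  then have ck': "(real b + 1) * k \<le> c * k" by (metis of_nat_1 of_nat_add of_nat_le_iff of_nat_mult)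
  consider "M = b" | "M = b + 1" | "M = 2" "b = 0" | "b \<ge> M + 1" using M by linarith
  then show False
  proof cases
    case 1
    then have "real (b * (k + 1)) = real (a + c * k)" using eq' by (simp add: algebra_simps)
    then have "b * (k + 1) = a + c * k" by (simp only: of_nat_eq_iff)
    then have "b * k + b = a + c * k" by simp
    moreover have "(b + 1) * k = b * k + k" by simp
    ultimately have "k \<le> b" using ck by linarith
    then show False using 1 M k by simp
  next
    case 2
    then have "s = real_of_int (int a + int c * int k - int b * (int k + 1))" using eq' by simp
    moreover from this have "2 * int k < int a + int c * int k - int b * (int k + 1)"
      "int a + int c * int k - int b * (int k + 1) < 2 * int k + 2"
      using s by linarith+
    then have "int a + int c * int k - int b * (int k + 1) = 2 * int k + 1" by simp
    ultimately show False using s1(1) by simp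
  next
    case 3
    then have s2: "2 * s = real (a + c * k)" using eq' by simp
    then have "4 * k < a + c * k" "a + c * k < 4 * k + 4" using s by linarith+
    then consider "a + c * k = 4 * k + 1" | "a + c * k = 4 * k + 2" | "a + c * k = 4 * k + 3" by linarith
    then show False using s1 unfolding s2 by cases (use s1 s2 in auto)
  next
    case 4
    have "(real b - real M) * s = real b * (real k + 1) - real a - real c * real k" using eq' by (simp add: algebra_simps)
    also have "\<dots> \<le> b - real k" using ck' by (simp add: algebra_simps)
    finally have le: "(real b - real M) * s \<le> real b - real k" .
    have "(real b - real M) * 6 \<le> (real b - real M) * s"
      using 4 s k by (intro mult_left_mono) auto
    from order_trans[OF this le] have "6 * real b - 6 * real M \<le> real b - real k" by simp
    moreover have "real M + 1 \<le> real b" "real M \<le> 2" "3 \<le> real k" using 4 M k by linarith+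
    ultimately show False by linarith
  qed
qed

text \<open>For \<open>s = 2 * k + 1\<close> both \<open>y\<close> and \<open>z\<close> equal
  \<open>k * x\<close>. Exactly \<open>2 * M\<close> of them leave \<open>a = M\<close>, more do not
  fit, and each one fewer adds \<open>k\<close> angles \<open>x\<close>.\<close>

lemma vertex_counts_isosceles:
  fixes a b c k M :: nat
  assumes k: "k \<ge> 3" and M: "M \<le> 2" and eq: "a + (b + c) * k = M * (2 * k + 1)"
  shows "b + c \<le> 2 * a"
proof -
  have "b + c \<le> 2 * M"
  proof (rule ccontr)
    assume "\<not> ?thesis"
    then have "(2 * M + 1) * k \<le> (b + c) * k" by (intro mult_le_mono1) simp
    then show False using eq M k by (simp add: algebra_simps)
  qed
  then consider "b + c = 2 * M" | d where "2 * M = b + c + d" "d \<ge> 1"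
    by (metis One_nat_def Suc_leI add_0_right gr0I le_Suc_ex)
  then show ?thesis
  proof cases
    case 1
    then show ?thesis using eq by (simp add: algebra_simps)
  next
    case (2 d)
    have "M * (2 * k + 1) = (2 * M) * k + M" by (simp add: algebra_simps)
    also have "\<dots> = (b + c + d) * k + M" unfolding 2(1) ..
    finally have "M * (2 * k + 1) = (b + c + d) * k + M" .
    then have "a = d * k + M" using eq by (simp add: algebra_simps)
    then show ?thesis using 2 by simp
  qed
qed

text \<open>These are the doubled equations for \<open>s = 2 * k + 1 / 2\<close> and
  \<open>s = 2 * k + 3 / 2\<close>. As \<open>k >= 4\<close>, at most four angles \<open>y\<close>
  or \<open>z\<close> fit, which leaves finitely many pairs \<open>b\<close>, \<open>c\<close>. For
  \<open>k = 3\<close> five can fit: 4y + z or 5z is then a full turn.\<close>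

lemma vertex_counts_quarter:
  fixes a b c k M :: nat
  assumes k: "k \<ge> 4" and M: "M \<le> 2"
  shows "2 * a + 2 * k * b + 2 * k * c = M * (4 * k + 1) + b \<Longrightarrow> 3 * b + c \<le> 4 * a"
    and "2 * a + 2 * k * b + b + 2 * k * c = M * (4 * k + 3) \<Longrightarrow> b + 3 * c \<le> 4 * a"
proof -
  have Mc: "M = 0 \<or> M = 1 \<or> M = 2" using M by auto
  \<comment> \<open>\<open>e\<close> stands for the surplus \<open>b\<close> on the right of the
    first equation; the second one has \<open>e = 0\<close>.\<close>
  have bound: "b + c \<le> 4"
    if eq: "2 * a + (2 * k * b + 2 * k * c) = m + e" and m: "m \<le> 8 * k + 6" "e \<le> b" "e = 0 \<or> m \<le> 8 * k + 2" for m e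
  proof (rule ccontr)
    assume "\<not> ?thesis"
    then have "5 \<le> b + c" by simp
    then obtain d where d: "b + c = 5 + d" by (rule le_Suc_ex[THEN exE])
    have "2 * k * b + 2 * k * c = 2 * k * (b + c)" by (simp add: algebra_simps)
    also have "\<dots> = 10 * k + 2 * k * d" unfolding d by (simp add: algebra_simps)
    finally have "2 * a + (10 * k + 2 * k * d) = m + e" using eq by simp
    moreover have "8 * d \<le> 2 * k * d" using k by (intro mult_le_mono1) simp
    ultimately show False using k d m by linarith
  qed
  {
    assume eq: "2 * a + 2 * k * b + 2 * k * c = M * (4 * k + 1) + b"
    have "M * (4 * k + 1) \<le> 2 * (4 * k + 1)" using M by (rule mult_le_mono1)
    with eq have bc: "b + c \<le> 4" by (intro bound[of "M * (4 * k + 1)" b]) auto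
    then have "b = 0 \<or> b = 1 \<or> b = 2 \<or> b = 3 \<or> b = 4" "c = 0 \<or> c = 1 \<or> c = 2 \<or> c = 3 \<or> c = 4" by auto
    then show "3 * b + c \<le> 4 * a" using eq Mc k bc by (elim disjE) (simp_all, (presburger)?)
  }
  {
    assume eq: "2 * a + 2 * k * b + b + 2 * k * c = M * (4 * k + 3)"
    have "M * (4 * k + 3) \<le> 2 * (4 * k + 3)" using M by (rule mult_le_mono1)
    with eq have bc: "b + c \<le> 4" by (intro bound[of "M * (4 * k + 3) - b" 0]) auto
    then have "b = 0 \<or> b = 1 \<or> b = 2 \<or> b = 3 \<or> b = 4" "c = 0 \<or> c = 1 \<or> c = 2 \<or> c = 3 \<or> c = 4" by auto
    then show "b + 3 * c \<le> 4 * a" using eq Mc k bc by (elim disjE) (simp_all, (presburger)?)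
  }
qed

section \<open>Tilings by similar triangles\<close>

lemma inner_dist: "(b - a) \<bullet> (c - a) = ((dist a b)\<^sup>2 + (dist a c)\<^sup>2 - (dist b c)\<^sup>2) / 2"
  for a b c :: "real^2"
  by (simp only: dist_norm norm_real2 inner_real2 vector_minus_component) (simp add: power2_eq_square algebra_simps)

text \<open>Written in distances alone, the angle is visibly invariant under similarities,
  reflections included.\<close>

lemma angle_at_dist:
  "angle_at a b c = arccos (((dist a b)\<^sup>2 + (dist a c)\<^sup>2 - (dist b c)\<^sup>2) / 2 / (dist a b * dist a c))"
  by (simp add: angle_at_def inner_dist dist_norm norm_minus_commute)

lemma angle_at_similar:
  assumes "c > 0" "dist a' b' = c * dist a b" "dist a' d' = c * dist a d" "dist b' d' = c * dist b d"
  shows "angle_at a' b' d' = angle_at a b d"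
proof -
  have "((c * dist a b)\<^sup>2 + (c * dist a d)\<^sup>2 - (c * dist b d)\<^sup>2) / 2 / (c * dist a b * (c * dist a d))
    = (c\<^sup>2 * (((dist a b)\<^sup>2 + (dist a d)\<^sup>2 - (dist b d)\<^sup>2) / 2)) / (c\<^sup>2 * (dist a b * dist a d))"
    by (simp add: power_mult_distrib algebra_simps power2_eq_square)
  also have "\<dots> = ((dist a b)\<^sup>2 + (dist a d)\<^sup>2 - (dist b d)\<^sup>2) / 2 / (dist a b * dist a d)"
    using assms(1) by simp
  finally show ?thesis unfolding angle_at_dist assms(2-4) by simp
qed

text \<open>The squared cross product is a polynomial in the distances, homogeneous of degree
  four.\<close>

lemma cross2_similar:
  assumes "c > 0" "dist a' b' = c * dist a b" "dist a' d' = c * dist a d" "dist b' d' = c * dist b d"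
    and "cross2 (b - a) (d - a) \<noteq> 0"
  shows "cross2 (b' - a') (d' - a') \<noteq> 0"
proof -
  have *: "(cross2 (q - p) (r - p))\<^sup>2
      = (dist p q)\<^sup>2 * (dist p r)\<^sup>2 - (((dist p q)\<^sup>2 + (dist p r)\<^sup>2 - (dist q r)\<^sup>2) / 2)\<^sup>2" for p q r
    unfolding cross2_square inner_dist by (simp add: dist_norm norm_minus_commute)
  have "(cross2 (b' - a') (d' - a'))\<^sup>2 = (c\<^sup>2)\<^sup>2 * (cross2 (b - a) (d - a))\<^sup>2"
    unfolding * assms(2-4) by (simp add: power_mult_distrib power2_eq_square) (simp add: field_simps)
  then show ?thesis using assms by auto
qed

text \<open>\<open>fX\<close>, \<open>fY\<close>, \<open>fZ\<close> mark the corners of a tile that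
  correspond to \<open>X\<close>, \<open>Y\<close>, \<open>Z\<close>. The assumption
  \<open>ratio\<close> records the comparison of areas.\<close>

locale similar_tiling =
  fixes X Y Z :: "real^2" and \<T> :: "(real^2) set set" and c :: real
    and fX fY fZ :: "(real^2) set \<Rightarrow> real^2"
  assumes D: "cross2 (Y - X) (Z - X) \<noteq> 0"
    and finite_tiles: "finite \<T>"
    and Union_tiles: "\<Union>\<T> = convex hull {X, Y, Z}"
    and disjoint_interiors: "pairwise (\<lambda>S S'. interior S \<inter> interior S' = {}) \<T>"
    and ratio_pos: "c > 0" and ratio: "c\<^sup>2 * card \<T> = 1"
    and tile: "\<And>S. S \<in> \<T> \<Longrightarrow> S = convex hull {fX S, fY S, fZ S}"
    and tile_dist: "\<And>S. S \<in> \<T> \<Longrightarrow> dist (fX S) (fY S) = c * dist X Y"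
      "\<And>S. S \<in> \<T> \<Longrightarrow> dist (fY S) (fZ S) = c * dist Y Z"
      "\<And>S. S \<in> \<T> \<Longrightarrow> dist (fX S) (fZ S) = c * dist X Z"
begin

definition "x = angle_at X Y Z"
definition "y = angle_at Y Z X"
definition "z = angle_at Z X Y"

definition "nX P = card {S \<in> \<T>. fX S = P}"
definition "nY P = card {S \<in> \<T>. fY S = P}"
definition "nZ P = card {S \<in> \<T>. fZ S = P}"

lemma angles_sum: "x + y + z = pi"
  unfolding x_def y_def z_def by (rule angle_sum[OF D])

lemma D': "cross2 (Z - Y) (X - Y) \<noteq> 0" "cross2 (X - Z) (Y - Z) \<noteq> 0"
  using D cross2_rotate[of Z Y X] cross2_rotate[of X Z Y] by simp_all

lemma angles_pos: "0 < x" "0 < y" "0 < z"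
  unfolding x_def y_def z_def
  using angle_at_cos_sin(3)[OF D] angle_at_cos_sin(3)[OF D'(1)] angle_at_cos_sin(3)[OF D'(2)] by auto

lemma vertices_distinct: "X \<noteq> Y" "Y \<noteq> Z" "X \<noteq> Z"
  using D by (auto simp: cross2_def)

lemma tile_nondegenerate:
  assumes "S \<in> \<T>"
  shows "cross2 (fY S - fX S) (fZ S - fX S) \<noteq> 0"
  by (rule cross2_similar[OF ratio_pos tile_dist(1)[OF assms] tile_dist(3)[OF assms] tile_dist(2)[OF assms] D])

lemma tile_angles:
  assumes "S \<in> \<T>"
  shows "angle_at (fX S) (fY S) (fZ S) = x" "angle_at (fY S) (fZ S) (fX S) = y"
    "angle_at (fZ S) (fX S) (fY S) = z"
proof -
  note d = tile_dist[OF assms]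
  have d': "dist (fY S) (fX S) = c * dist Y X" "dist (fZ S) (fY S) = c * dist Z Y"
    "dist (fZ S) (fX S) = c * dist Z X"
    using d by (simp_all add: dist_commute)
  show "angle_at (fX S) (fY S) (fZ S) = x" "angle_at (fY S) (fZ S) (fX S) = y"
    "angle_at (fZ S) (fX S) (fY S) = z"
    unfolding x_def y_def z_def
    by (rule angle_at_similar[OF ratio_pos d(1) d(3) d(2)] angle_at_similar[OF ratio_pos d(2) d'(1) d'(3)]
        angle_at_similar[OF ratio_pos d'(3) d'(2) d(1)])+
qed

lemma tile_aperture:
  assumes "S \<in> \<T>"
  shows "\<exists>h::nat. (P \<in> S - {fX S, fY S, fZ S} \<longrightarrow> Suc 0 \<le> h) \<and>
    aperture P S = (if P = fX S then x else 0) + (if P = fY S then y else 0)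
      + (if P = fZ S then z else 0) + pi * h"
  using conjunct2[OF aperture_triangle[OF tile_nondegenerate[OF assms], of P]]
  unfolding tile[OF assms, symmetric] tile_angles[OF assms]
  by (elim ex_forward conjE, intro conjI)

lemma sum_aperture: "aperture P (convex hull {X, Y, Z}) = (\<Sum>S\<in>\<T>. aperture P S)"
  unfolding Union_tiles[symmetric]
proof (rule aperture_Union[OF finite_tiles _ _ _ disjoint_interiors])
  show "convex (\<Union>\<T>)" unfolding Union_tiles by simp
  fix S assume S: "S \<in> \<T>"
  show "closed S" "convex S"
    by (subst tile[OF S], simp add: compact_imp_closed finite_imp_compact_convex_hull)+
  show "inward P S \<inter> {0..<2 * pi} \<in> lmeasurable"
    using aperture_triangle[OF tile_nondegenerate[OF S], of P] tile[OF S] by simp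
qed

text \<open>Apertures of all tiles at \<open>P\<close> are summed. \<open>H\<close> collects the
  half turns, and each tile that contains \<open>P\<close> away from its vertices contributes at
  least one.\<close>

lemma aperture_eq:
  obtains H :: nat where
    "nX P * x + nY P * y + nZ P * z + pi * H = aperture P (convex hull {X, Y, Z})"
    "\<And>S. S \<in> \<T> \<Longrightarrow> P \<in> S \<Longrightarrow> H = 0 \<Longrightarrow> P \<in> {fX S, fY S, fZ S}"
proof -
  have "\<forall>S\<in>\<T>. \<exists>h::nat. (P \<in> S - {fX S, fY S, fZ S} \<longrightarrow> Suc 0 \<le> h) \<and>
    aperture P S = (if P = fX S then x else 0) + (if P = fY S then y else 0)
      + (if P = fZ S then z else 0) + pi * h"
    using tile_aperture by (rule ballI)
  then obtain h :: "(real^2) set \<Rightarrow> nat" where h: "\<forall>S\<in>\<T>. (P \<in> S - {fX S, fY S, fZ S} \<longrightarrow> Suc 0 \<le> h S) \<and>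
    aperture P S = (if P = fX S then x else 0) + (if P = fY S then y else 0)
      + (if P = fZ S then z else 0) + pi * h S"
    by (rule bchoice[THEN exE])
  have cnt: "(\<Sum>S\<in>\<T>. if P = f S then w else 0) = card {S \<in> \<T>. f S = P} * w"
    for f :: "(real^2) set \<Rightarrow> real^2" and w :: real
    using finite_tiles by (simp add: sum.inter_filter[symmetric] eq_commute[of P])
  have "aperture P (convex hull {X, Y, Z}) = (\<Sum>S\<in>\<T>. (if P = fX S then x else 0)
      + (if P = fY S then y else 0) + (if P = fZ S then z else 0) + pi * h S)"
    unfolding sum_aperture using h by (intro sum.cong) auto
  also have "\<dots> = nX P * x + nY P * y + nZ P * z + pi * sum h \<T>"
    by (simp add: sum.distrib cnt sum_distrib_left nX_def nY_def nZ_def)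
  finally have "nX P * x + nY P * y + nZ P * z + pi * sum h \<T> = aperture P (convex hull {X, Y, Z})" ..
  moreover have "P \<in> {fX S, fY S, fZ S}" if "S \<in> \<T>" "P \<in> S" "sum h \<T> = 0" for S
  proof -
    have "h S = 0" using that finite_tiles by simp
    then show ?thesis using h that by force
  qed
  ultimately show thesis by (rule that)
qed

lemma count_card:
  assumes "\<And>S. S \<in> \<T> \<Longrightarrow> P \<in> S \<Longrightarrow> P \<in> {fX S, fY S, fZ S}"
  shows "card {S \<in> \<T>. P \<in> S} = nX P + nY P + nZ P"
proof -
  have sub: "fX S \<in> S" "fY S \<in> S" "fZ S \<in> S" if "S \<in> \<T>" for S
    by (subst (2) tile[OF that], simp add: hull_inc)+
  have ne: "fX S \<noteq> fY S" "fY S \<noteq> fZ S" "fX S \<noteq> fZ S" if "S \<in> \<T>" for S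
    using tile_nondegenerate[OF that] by (auto simp: cross2_def)
  have "{S \<in> \<T>. P \<in> S} = ({S \<in> \<T>. fX S = P} \<union> {S \<in> \<T>. fY S = P}) \<union> {S \<in> \<T>. fZ S = P}"
    using assms sub by blast
  also have "card \<dots> = card ({S \<in> \<T>. fX S = P} \<union> {S \<in> \<T>. fY S = P}) + card {S \<in> \<T>. fZ S = P}"
    using finite_tiles by (intro card_Un_disjoint) (auto dest: ne)
  also have "card ({S \<in> \<T>. fX S = P} \<union> {S \<in> \<T>. fY S = P}) = card {S \<in> \<T>. fX S = P} + card {S \<in> \<T>. fY S = P}"
    using finite_tiles by (intro card_Un_disjoint) (auto dest: ne)
  finally show ?thesis by (simp add: nX_def nY_def nZ_def)
qed

lemma aperture_corner:
  assumes "P \<in> {X, Y, Z}"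
  shows "aperture P (convex hull {X, Y, Z}) = (if P = X then x else if P = Y then y else z)"
  using aperture_triangle[OF D, of P] assms vertices_distinct
  by (auto simp: x_def y_def z_def)

text \<open>A corner angle is below pi, which leaves no room for a half turn, so
  \<open>H = 0\<close>.\<close>

lemma corner_counts:
  assumes "P \<in> {X, Y, Z}"
  shows "nX P * x + nY P * y + nZ P * z = (if P = X then x else if P = Y then y else z)"
    and "\<And>S. S \<in> \<T> \<Longrightarrow> P \<in> S \<Longrightarrow> P \<in> {fX S, fY S, fZ S}"
proof -
  obtain H :: nat where H: "nX P * x + nY P * y + nZ P * z + pi * H = aperture P (convex hull {X, Y, Z})"
    "\<And>S. S \<in> \<T> \<Longrightarrow> P \<in> S \<Longrightarrow> H = 0 \<Longrightarrow> P \<in> {fX S, fY S, fZ S}"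
    using aperture_eq by blast
  have "0 \<le> nX P * x + nY P * y + nZ P * z" using angles_pos by simp
  moreover have "aperture P (convex hull {X, Y, Z}) < pi"
    using angles_sum angles_pos unfolding aperture_corner[OF assms] by auto
  ultimately have "pi * H < pi * 1" using H(1) by linarith
  then have "real H < 1" by (simp only: mult_less_cancel_left_pos[OF pi_gt_zero])
  then have "H = 0" by simp
  then show "nX P * x + nY P * y + nZ P * z = (if P = X then x else if P = Y then y else z)"
    "\<And>S. S \<in> \<T> \<Longrightarrow> P \<in> S \<Longrightarrow> P \<in> {fX S, fY S, fZ S}"
    using H unfolding aperture_corner[OF assms] by simp_all
qed

text \<open>Away from its corners the aperture of the whole triangle is 0, pi or 2 pi; the half
  turns of the tiles are subtracted from it.\<close>

lemma inner_counts:
  assumes "P \<notin> {X, Y, Z}"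
  obtains M :: nat where "M \<le> 2" "nX P * x + nY P * y + nZ P * z = M * pi"
proof -
  obtain H :: nat where H: "nX P * x + nY P * y + nZ P * z + pi * H = aperture P (convex hull {X, Y, Z})"
    using aperture_eq by blast
  obtain N :: nat where N: "N \<le> 2" "aperture P (convex hull {X, Y, Z}) = pi * N"
    using aperture_triangle[OF D, of P] assms by auto
  have "0 \<le> nX P * x + nY P * y + nZ P * z" using angles_pos by simp
  then have "pi * H \<le> pi * N" using H N by linarith
  then have "H \<le> N" by (simp only: mult_le_cancel_left_pos[OF pi_gt_zero] of_nat_le_iff)
  then have "nX P * x + nY P * y + nZ P * z = real (N - H) * pi"
    using H N(2) by (simp add: of_nat_diff algebra_simps)
  then show thesis using that[of "N - H"] N(1) by simp
qed

definition "corners = fX ` \<T> \<union> fY ` \<T> \<union> fZ ` \<T> \<union> {X, Y, Z}"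

lemma finite_corners: "finite corners"
  unfolding corners_def using finite_tiles by simp

lemma sum_counts: "(\<Sum>P\<in>corners. nX P) = card \<T>" "(\<Sum>P\<in>corners. nY P) = card \<T>" "(\<Sum>P\<in>corners. nZ P) = card \<T>"
proof -
  have "(\<Sum>P\<in>corners. card {S \<in> \<T>. f S = P}) = card \<T>" if "f ` \<T> \<subseteq> corners" for f :: "(real^2) set \<Rightarrow> real^2"
    using sum.group[OF finite_tiles finite_corners that, of "\<lambda>_. 1 :: nat"] by simp
  then show "(\<Sum>P\<in>corners. nX P) = card \<T>" "(\<Sum>P\<in>corners. nY P) = card \<T>" "(\<Sum>P\<in>corners. nZ P) = card \<T>"
    unfolding nX_def nY_def nZ_def by (auto simp: corners_def)
qed

text \<open>Every tile has one corner of each kind, so a weight of total zero sums to zero over all points.\<close>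

lemma no_positive_weight:
  fixes f1 f2 f3 :: int
  defines "F \<equiv> \<lambda>P. f1 * nX P + f2 * nY P + f3 * nZ P"
  assumes "f1 + f2 + f3 = 0" and nonneg: "\<And>P. P \<notin> {X, Y, Z} \<Longrightarrow> F P \<ge> 0"
  shows "F X + F Y + F Z \<le> 0"
proof -
  have "sum F corners = f1 * int (\<Sum>P\<in>corners. nX P) + f2 * int (\<Sum>P\<in>corners. nY P) + f3 * int (\<Sum>P\<in>corners. nZ P)"
    by (simp add: F_def sum.distrib sum_distrib_left)
  also have "\<dots> = (f1 + f2 + f3) * card \<T>" unfolding sum_counts by (simp add: algebra_simps)
  finally have "sum F corners = 0" using assms(2) by simp
  moreover have "sum F corners = sum F {X, Y, Z} + sum F (corners - {X, Y, Z})"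
    using finite_corners by (intro sum.subset_diff[THEN trans, OF _ _ add.commute]) (auto simp: corners_def)
  moreover have "sum F (corners - {X, Y, Z}) \<ge> 0" using nonneg by (intro sum_nonneg) auto
  moreover have "sum F {X, Y, Z} = F X + F Y + F Z" using vertices_distinct by simp
  ultimately show ?thesis by linarith
qed

section \<open>Tile edges along a side\<close>


definition side :: "real \<Rightarrow> real^2" where
  "side t = Z + t *\<^sub>R (Y - Z)"

lemma side_inj: "side s = side t \<longleftrightarrow> s = t"
  using vertices_distinct by (simp add: side_def)

lemma side_0 [simp]: "side 0 = Z" and side_1 [simp]: "side 1 = Y"
  by (simp_all add: side_def)

lemma side_convex: "u + v = 1 \<Longrightarrow> u *\<^sub>R side s + v *\<^sub>R side t = side (u * s + v * t)"
proof -
  assume "u + v = 1"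
  then have v: "v = 1 - u" by simp
  show ?thesis unfolding v by (simp add: side_def algebra_simps)
qed

lemma dist_side: "dist (side s) (side t) = \<bar>s - t\<bar> * dist Y Z"
proof -
  have "side s - side t = (s - t) *\<^sub>R (Y - Z)" by (simp add: side_def algebra_simps)
  then show ?thesis by (simp add: dist_norm)
qed

lemma bary_side: "bary X Y Z (side t) = 0" "bary Y Z X (side t) = t" "bary Z X Y (side t) = 1 - t"
proof -
  have s: "side t = 0 *\<^sub>R X + t *\<^sub>R Y + (1 - t) *\<^sub>R Z" by (simp add: side_def algebra_simps)
  show "bary X Y Z (side t) = 0" "bary Y Z X (side t) = t" "bary Z X Y (side t) = 1 - t"
    unfolding s by (subst bary_affine; simp add: bary_vertex[OF D] bary_vertex[OF D'(1)] bary_vertex[OF D'(2)])+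
qed

lemma side_of_bary:
  assumes "bary X Y Z P = 0"
  obtains t where "P = side t"
proof -
  have "P = bary Y Z X P *\<^sub>R Y + bary Z X Y P *\<^sub>R Z"
    using bary_combination[OF D, of P] assms by simp
  moreover have "bary Z X Y P = 1 - bary Y Z X P" using bary_sum[OF D, of P] assms by simp
  ultimately have "P = side (bary Y Z X P)" by (simp add: side_def algebra_simps)
  then show thesis by (rule that)
qed

lemma side_mem_iff: "side t \<in> convex hull {X, Y, Z} \<longleftrightarrow> 0 \<le> t \<and> t \<le> 1"
  unfolding triangle_iff[OF D] bary_side by auto

lemma hull_bary_combination:
  assumes "P \<in> convex hull {A, B, C}"
  obtains u v w where "0 \<le> u" "0 \<le> v" "0 \<le> w" "u + v + w = 1" "P = u *\<^sub>R A + v *\<^sub>R B + w *\<^sub>R C"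
    "bary X Y Z P = u * bary X Y Z A + v * bary X Y Z B + w * bary X Y Z C"
  using assms unfolding convex_hull_3 by (auto simp: bary_affine)

text \<open>The coordinate \<open>bary X Y Z\<close> vanishes along the side, and a convex
  combination of nonnegative values vanishes only if the positive ones have weight 0.\<close>

lemma trace_point:
  assumes "0 \<le> bary X Y Z A" "0 < bary X Y Z B" "0 < bary X Y Z C"
    and t: "side t \<in> convex hull {A, B, C}"
  shows "side t = A"
proof -
  obtain u v w where uvw: "0 \<le> u" "0 \<le> v" "0 \<le> w" "u + v + w = 1"
    "side t = u *\<^sub>R A + v *\<^sub>R B + w *\<^sub>R C"
    "bary X Y Z (side t) = u * bary X Y Z A + v * bary X Y Z B + w * bary X Y Z C"
    using hull_bary_combination[OF t] by blast
  have nn: "0 \<le> u * bary X Y Z A" "0 \<le> v * bary X Y Z B" "0 \<le> w * bary X Y Z C"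
    using uvw assms by simp_all
  then have "v * bary X Y Z B = 0" "w * bary X Y Z C = 0"
    using uvw(6) unfolding bary_side by linarith+
  then have "v = 0" "w = 0" using assms by auto
  then show ?thesis using uvw by simp
qed

lemma trace_edge:
  assumes A: "bary X Y Z A = 0" "A \<in> convex hull {X, Y, Z}"
    and B: "bary X Y Z B = 0" "B \<in> convex hull {X, Y, Z}" and C: "0 < bary X Y Z C"
  shows "measure lebesgue {t \<in> {0..1}. side t \<in> convex hull {A, B, C}} * dist Y Z = dist A B"
proof -
  obtain p where p: "A = side p" using side_of_bary[OF A(1)] .
  obtain q where q: "B = side q" using side_of_bary[OF B(1)] .
  have pq: "0 \<le> p" "p \<le> 1" "0 \<le> q" "q \<le> 1" using A(2) B(2) unfolding p q side_mem_iff by auto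
  have "{t \<in> {0..1}. side t \<in> convex hull {A, B, C}} = closed_segment p q"
  proof (intro equalityI subsetI)
    fix t assume "t \<in> {t \<in> {0..1}. side t \<in> convex hull {A, B, C}}"
    then have "side t \<in> convex hull {A, B, C}" by simp
    then obtain u v w where uvw: "0 \<le> u" "0 \<le> v" "0 \<le> w" "u + v + w = 1"
      "side t = u *\<^sub>R A + v *\<^sub>R B + w *\<^sub>R C"
      "bary X Y Z (side t) = u * bary X Y Z A + v * bary X Y Z B + w * bary X Y Z C"
      using hull_bary_combination by blast
    have "w = 0" using uvw(6) C unfolding bary_side A(1) B(1) by simp
    then have "side t = side (u * p + v * q)" "u = 1 - v" using uvw side_convex[of u v p q] by (simp_all add: p q)
    then have "t = u * p + v * q" by (simp only: side_inj)
    then show "t \<in> closed_segment p q"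
      using uvw \<open>w = 0\<close> \<open>u = 1 - v\<close> unfolding closed_segment_def by (auto intro!: exI[of _ v])
  next
    fix t assume "t \<in> closed_segment p q"
    then obtain v where v: "0 \<le> v" "v \<le> 1" "t = (1 - v) * p + v * q" unfolding closed_segment_def by auto
    have "side t = (1 - v) *\<^sub>R A + v *\<^sub>R B" unfolding v p q by (rule side_convex[symmetric]) simp
    moreover have "A \<in> convex hull {A, B, C}" "B \<in> convex hull {A, B, C}" by (simp_all add: hull_inc)
    ultimately have "side t \<in> convex hull {A, B, C}"
      using v convexD[OF convex_convex_hull, of A _ B "1 - v" v] by simp
    moreover have "t \<in> {0..1}"
      using \<open>t \<in> closed_segment p q\<close> pq by (auto simp: closed_segment_eq_real_ivl split: if_splits)
    ultimately show "t \<in> {t \<in> {0..1}. side t \<in> convex hull {A, B, C}}" by simp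
  qed
  then have "measure lebesgue {t \<in> {0..1}. side t \<in> convex hull {A, B, C}} = \<bar>p - q\<bar>"
    by (simp add: closed_segment_eq_real_ivl)
  then show ?thesis unfolding p q dist_side by simp
qed

definition side_trace :: "(real^2) set \<Rightarrow> real set" where
  "side_trace S = {t \<in> {0..1}. side t \<in> S}"

lemma tile_subset: "S \<in> \<T> \<Longrightarrow> S \<subseteq> convex hull {X, Y, Z}"
  using Union_tiles by blast

lemma tile_vertices_mem:
  assumes "S \<in> \<T>"
  shows "fX S \<in> S" "fY S \<in> S" "fZ S \<in> S"
  by (subst (2) tile[OF assms], simp add: hull_inc)+

text \<open>The cases tell which corners of the tile lie on the line of the side. Two of them make
  the trace a full tile edge, fewer leave at most a point, and three contradict nondegeneracy.
  \<open>n1\<close> stands for the edge opposite the corner \<open>fX S\<close>, so a tile with this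
  corner at \<open>Z\<close> contributes to \<open>n2\<close> or \<open>n3\<close>.\<close>

lemma trace_tile:
  assumes S: "S \<in> \<T>"
  shows "\<exists>n1 n2 n3.
    measure lebesgue (side_trace S) * dist Y Z = c * (real n1 * dist Y Z + real n2 * dist Z X + real n3 * dist X Y) \<and>
    (fX S = Z \<and> (\<exists>t. t \<noteq> 0 \<and> side t \<in> S) \<longrightarrow> Suc 0 \<le> n2 + n3)"
proof -
  define A B C where "A = fX S" and "B = fY S" and "C = fZ S"
  have mem: "A \<in> convex hull {X, Y, Z}" "B \<in> convex hull {X, Y, Z}" "C \<in> convex hull {X, Y, Z}"
    using tile_vertices_mem[OF S] tile_subset[OF S] by (auto simp: A_def B_def C_def)
  then have nn: "0 \<le> bary X Y Z A" "0 \<le> bary X Y Z B" "0 \<le> bary X Y Z C"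
    unfolding triangle_iff[OF D] by auto
  have hull: "S = convex hull {A, B, C}" using tile[OF S] by (simp add: A_def B_def C_def)
  have perm: "{B, A, C} = {A, B, C}" "{C, A, B} = {A, B, C}" "{B, C, A} = {A, B, C}" "{A, C, B} = {A, B, C}" by auto
  have d: "dist A B = c * dist X Y" "dist B C = c * dist Y Z" "dist A C = c * dist Z X"
    using tile_dist[OF S] by (simp_all add: A_def B_def C_def dist_commute)
  \<comment> \<open>A trace within one point has length 0. If \<open>fX S\<close> is
    \<open>Z\<close>, that point is \<open>Z\<close> itself, so the second conjunct holds
    vacuously.\<close>
  have point: ?thesis if "\<And>t. side t \<in> S \<Longrightarrow> side t = Q" "A = Z \<longrightarrow> Q = Z" for Q
  proof -
    have "side_trace S \<subseteq> side -` {Q}" using that by (auto simp: side_trace_def)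
    moreover have "finite (side -` {Q})" by (intro finite_vimageI) (auto simp: inj_on_def side_inj)
    ultimately have "finite (side_trace S)" by (rule finite_subset)
    then have "measure lebesgue (side_trace S) = 0" by (simp add: negligible_finite negligible_imp_measure0)
    moreover have "\<not> (A = Z \<and> (\<exists>t. t \<noteq> 0 \<and> side t \<in> S))"
      using that side_inj[of _ 0] by force
    ultimately show ?thesis by (intro exI[of _ 0]) (simp add: A_def)
  qed
  note E = trace_edge[OF _ mem(1) _ mem(2)] trace_edge[OF _ mem(2) _ mem(3), of A, unfolded perm]
    trace_edge[OF _ mem(1) _ mem(3), of B, unfolded perm]
  have "bary X Y Z A = 0 \<or> 0 < bary X Y Z A" "bary X Y Z B = 0 \<or> 0 < bary X Y Z B"
    "bary X Y Z C = 0 \<or> 0 < bary X Y Z C" using nn by linarith+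
  then consider "bary X Y Z A = 0" "bary X Y Z B = 0" "bary X Y Z C = 0"
    | "bary X Y Z A = 0" "bary X Y Z B = 0" "0 < bary X Y Z C"
    | "0 < bary X Y Z A" "bary X Y Z B = 0" "bary X Y Z C = 0"
    | "bary X Y Z A = 0" "0 < bary X Y Z B" "bary X Y Z C = 0"
    | "0 < bary X Y Z B" "0 < bary X Y Z C"
    | "0 < bary X Y Z A" "0 < bary X Y Z C"
    | "0 < bary X Y Z A" "0 < bary X Y Z B"
    by blast
  then show ?thesis
  proof cases
    case 1
    then obtain p q r where pqr: "A = side p" "B = side q" "C = side r" by (metis side_of_bary)
    have "cross2 (B - A) (C - A) = 0"
      unfolding pqr by (simp add: side_def cross2_def algebra_simps)
    then show ?thesis using tile_nondegenerate[OF S] by (simp add: A_def B_def C_def)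
  next
    case 2
    from E(1)[OF 2] show ?thesis
      unfolding d hull[symmetric] side_trace_def by (intro exI[of _ 0] exI[of _ 1]) simp
  next
    case 3
    from E(2)[OF 3(2,3,1)] have "measure lebesgue (side_trace S) * dist Y Z = c * dist Y Z"
      unfolding d hull[symmetric] side_trace_def .
    moreover have "A \<noteq> Z" using 3(1) bary_vertex[OF D] by auto
    ultimately show ?thesis by (intro exI[of _ 1] exI[of _ 0]) (simp add: A_def)
  next
    case 4
    from E(3)[OF 4(1,3,2)] have "measure lebesgue (side_trace S) * dist Y Z = c * dist Z X"
      unfolding d hull[symmetric] side_trace_def .
    then show ?thesis by (intro exI[of _ 0] exI[of _ 1] exI[of _ 0]) simp
  next
    case 5
    then show ?thesis using trace_point[OF nn(1) 5] unfolding hull[symmetric] by (intro point[of A]) auto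
  next
    case 6
    have "A \<noteq> Z" using 6(1) bary_vertex[OF D] by auto
    then show ?thesis using trace_point[OF nn(2) 6, unfolded perm] unfolding hull[symmetric] by (intro point[of B]) auto
  next
    case 7
    have "A \<noteq> Z" using 7(1) bary_vertex[OF D] by auto
    then show ?thesis using trace_point[OF nn(3) 7, unfolded perm] unfolding hull[symmetric] by (intro point[of C]) auto
  qed
qed

lemma aperture_nonneg: "0 \<le> aperture P S"
  by (simp add: aperture_def)

text \<open>At a point of the side that is no corner, each tile containing it has aperture at least
  pi, while the whole triangle offers only pi. Overlaps are thus confined to the finitely many
  corners.\<close>

lemma finite_trace_Int:
  assumes S: "S \<in> \<T>" "S' \<in> \<T>" "S \<noteq> S'"
  shows "finite (side_trace S \<inter> side_trace S')"
proof -
  have "side_trace S \<inter> side_trace S' \<subseteq> side -` corners"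
  proof
    fix t assume t: "t \<in> side_trace S \<inter> side_trace S'"
    show "t \<in> side -` corners"
    proof (rule ccontr)
      assume "t \<notin> side -` corners"
      then have out: "side t \<notin> corners" by simp
      have ge: "pi \<le> aperture (side t) R" if "R \<in> \<T>" "side t \<in> R" for R
      proof -
        have nv: "side t \<notin> {fX R, fY R, fZ R}" using out that(1) by (auto simp: corners_def)
        with tile_aperture[OF that(1), of "side t"] that(2) obtain h :: nat
          where "Suc 0 \<le> h" "aperture (side t) R = pi * h" by auto
        then show ?thesis by simp
      qed
      have "2 * pi \<le> aperture (side t) S + aperture (side t) S'"
        using ge[OF S(1)] ge[OF S(2)] t by (simp add: side_trace_def)
      also have "\<dots> = (\<Sum>R\<in>{S, S'}. aperture (side t) R)" using S by simp
      also have "\<dots> \<le> (\<Sum>R\<in>\<T>. aperture (side t) R)"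
        using S finite_tiles by (intro sum_mono2) (auto simp: aperture_nonneg)
      also have "\<dots> = aperture (side t) (convex hull {X, Y, Z})" by (simp add: sum_aperture)
      also have "\<dots> = pi"
      proof (rule aperture_edge(2)[OF D])
        have nv: "side t \<noteq> Y" "side t \<noteq> Z" using out by (auto simp: corners_def)
        then have "t \<noteq> 0" "t \<noteq> 1" by auto
        then show "bary Y Z X (side t) \<noteq> 0" "bary Z X Y (side t) \<noteq> 0" by (simp_all add: bary_side)
        show "side t \<in> convex hull {X, Y, Z}" using t by (simp add: side_mem_iff side_trace_def)
      qed (simp add: bary_side)
      finally show False by simp
    qed
  qed
  moreover have "finite (side -` corners)" by (intro finite_vimageI finite_corners) (auto simp: inj_on_def side_inj)
  ultimately show ?thesis by (rule finite_subset)
qed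

lemma sum_trace: "(\<Sum>S\<in>\<T>. measure lebesgue (side_trace S)) = 1"
proof -
  have "measure lebesgue (\<Union>(side_trace ` \<T>)) = (\<Sum>S\<in>\<T>. measure lebesgue (side_trace S))"
  proof (rule measure_negligible_finite_Union_image[OF finite_tiles])
    fix S assume S: "S \<in> \<T>"
    have "closed S" by (subst tile[OF S]) (simp add: compact_imp_closed finite_imp_compact_convex_hull)
    then have "closed (side -` S)"
      by (rule closed_vimage) (unfold side_def, intro continuous_intros)
    then have "compact ({0..1} \<inter> side -` S)" by (intro compact_Int_closed) auto
    moreover have "side_trace S = {0..1} \<inter> side -` S" by (auto simp: side_trace_def)
    ultimately show "side_trace S \<in> lmeasurable" by (simp add: lmeasurable_compact)
  next
    show "pairwise (\<lambda>S S'. negligible (side_trace S \<inter> side_trace S')) \<T>"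
      by (intro pairwiseI negligible_finite finite_trace_Int)
  qed
  moreover have "\<Union>(side_trace ` \<T>) = {0..1}"
    using side_mem_iff unfolding Union_tiles[symmetric] by (auto simp: side_trace_def)
  ultimately show ?thesis by simp
qed

text \<open>The traces of all tiles add up to the side. The tile that covers the beginning of the
  side at \<open>Z\<close> has its \<open>fX\<close> corner there, which supplies an edge counted by
  \<open>n2\<close> or \<open>n3\<close>.\<close>

lemma side_relation:
  assumes Z: "\<And>S. S \<in> \<T> \<Longrightarrow> Z \<in> S \<Longrightarrow> fX S = Z"
  shows "\<exists>n1 n2 n3. dist Y Z = c * (real n1 * dist Y Z + real n2 * dist Z X + real n3 * dist X Y) \<and> Suc 0 \<le> n2 + n3"
proof -
  define R where "R S n1 n2 n3 \<longleftrightarrow>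
    measure lebesgue (side_trace S) * dist Y Z = c * (real n1 * dist Y Z + real n2 * dist Z X + real n3 * dist X Y) \<and>
    (fX S = Z \<and> (\<exists>t. t \<noteq> 0 \<and> side t \<in> S) \<longrightarrow> Suc 0 \<le> n2 + n3)" for S n1 n2 n3
  have "\<forall>S\<in>\<T>. \<exists>n1 n2 n3. R S n1 n2 n3" unfolding R_def by (intro ballI trace_tile)
  then obtain n1 n2 n3 where n: "\<forall>S\<in>\<T>. R S (n1 S) (n2 S) (n3 S)" by metis
  have "dist Y Z = (\<Sum>S\<in>\<T>. measure lebesgue (side_trace S) * dist Y Z)"
    unfolding sum_distrib_right[symmetric] sum_trace by simp
  also have "\<dots> = (\<Sum>S\<in>\<T>. c * (real (n1 S) * dist Y Z + real (n2 S) * dist Z X + real (n3 S) * dist X Y))"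
    using n unfolding R_def by (intro sum.cong) auto
  also have "\<dots> = c * (real (sum n1 \<T>) * dist Y Z + real (sum n2 \<T>) * dist Z X + real (sum n3 \<T>) * dist X Y)"
    by (simp add: sum_distrib_left[symmetric] sum_distrib_right[symmetric] sum.distrib)
  finally have eq: "dist Y Z = c * (real (sum n1 \<T>) * dist Y Z + real (sum n2 \<T>) * dist Z X + real (sum n3 \<T>) * dist X Y)" .
  have "Y - Z \<noteq> 0" using vertices_distinct by simp
  then obtain s where s: "Y - Z = norm (Y - Z) *\<^sub>R direction s" using polar by blast
  have "Z + norm (Y - Z) *\<^sub>R direction s = Y" by (simp add: s[symmetric])
  \<comment> \<open>Some tile has the direction of the side as an inward direction at
    \<open>Z\<close>, so its trace is more than the point \<open>Z\<close>.\<close>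
  then have "s \<in> inward Z (convex hull {X, Y, Z})"
    unfolding inward_def using vertices_distinct
    by (auto simp: hull_inc intro!: exI[of _ "norm (Y - Z)"])
  moreover have "inward Z (\<Union>\<T>) = (\<Union>S\<in>\<T>. inward Z S)"
  proof (rule inward_Union[OF finite_tiles])
    show "convex (\<Union>\<T>)" unfolding Union_tiles by simp
    fix S assume "S \<in> \<T>"
    from tile[OF this] show "closed S" by (metis compact_imp_closed finite.emptyI finite.insertI finite_imp_compact_convex_hull)
  qed
  ultimately obtain S where S: "S \<in> \<T>" "s \<in> inward Z S" unfolding Union_tiles by blast
  then obtain e where e: "Z \<in> S" "e > 0" "Z + e *\<^sub>R direction s \<in> S" unfolding inward_def by blast
  have "Z + e *\<^sub>R direction s = side (e / norm (Y - Z))"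
    unfolding side_def by (subst s) (use vertices_distinct in simp)
  moreover have "e / norm (Y - Z) \<noteq> 0" using e vertices_distinct by simp
  ultimately have "\<exists>t. t \<noteq> 0 \<and> side t \<in> S" using e by metis
  then have "Suc 0 \<le> n2 S + n3 S" using n S Z e unfolding R_def by blast
  also have "n2 S + n3 S \<le> sum n2 \<T> + sum n3 \<T>"
    using S finite_tiles by (intro add_mono member_le_sum) auto
  finally show ?thesis using eq by blast
qed

lemma law_of_sines: "dist Z X * sin x = dist Y Z * sin y" "dist X Y * sin x = dist Y Z * sin z"
proof -
  define d where "d = \<bar>cross2 (Y - X) (Z - X)\<bar>"
  have "sin x = d / (dist X Y * dist Z X)" "sin y = d / (dist Y Z * dist X Y)"
    "sin z = d / (dist Z X * dist Y Z)"
    using angle_at_cos_sin(2)[OF D] angle_at_cos_sin(2)[OF D'(1)] angle_at_cos_sin(2)[OF D'(2)]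
      cross2_rotate[of Z Y X] cross2_rotate[of X Z Y]
    by (simp_all add: x_def y_def z_def d_def dist_norm norm_minus_commute)
  then show "dist Z X * sin x = dist Y Z * sin y" "dist X Y * sin x = dist Y Z * sin z"
    using vertices_distinct by simp_all
qed

lemma no_exceptional_split:
  assumes Z: "\<And>S. S \<in> \<T> \<Longrightarrow> Z \<in> S \<Longrightarrow> fX S = Z"
    and z3: "z = 3 * x" and x: "x = 2 * pi / 13 \<or> x = 2 * pi / 15"
  shows False
proof -
  define u where "u = 2 * cos x"
  have sx: "sin x > 0" using angles_pos angles_sum by (intro sin_gt_zero) linarith+
  \<comment> \<open>Thus \<open>sin z\<close> and \<open>sin y\<close> equal
    \<open>sin (3 * x)\<close> and \<open>sin (4 * x)\<close>, which are \<open>sin x\<close> times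
    polynomials in \<open>u\<close>. The law of sines then expresses the other two sides through
    \<open>dist Y Z\<close>.\<close>
  have y4: "y = pi - 4 * x" using angles_sum z3 by simp
  have "sin z = sin x * (u\<^sup>2 - 1)"
  proof -
    have "sin (3 * x) = sin (2 * x + x)" by simp
    also have "\<dots> = sin x * (u\<^sup>2 - 1)"
      unfolding sin_add sin_double cos_double_cos by (simp add: u_def power2_eq_square algebra_simps)
    finally show ?thesis by (simp add: z3)
  qed
  then have "dist X Y * sin x = (dist Y Z * (u\<^sup>2 - 1)) * sin x" using law_of_sines(2) by simp
  then have c_eq: "dist X Y = dist Y Z * (u\<^sup>2 - 1)" using sx by (simp only: mult_cancel_right) simp
  have "sin y = sin x * (u ^ 3 - 2 * u)"
  proof -
    have "sin y = sin (2 * (2 * x))" unfolding y4 by simp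
    also have "\<dots> = 2 * (2 * sin x * cos x) * (2 * (cos x)\<^sup>2 - 1)"
      by (simp only: sin_double cos_double_cos)
    also have "\<dots> = sin x * (u ^ 3 - 2 * u)"
      by (simp add: u_def power2_eq_square power3_eq_cube algebra_simps)
    finally show ?thesis .
  qed
  then have "dist Z X * sin x = (dist Y Z * (u ^ 3 - 2 * u)) * sin x" using law_of_sines(1) by simp
  then have b_eq: "dist Z X = dist Y Z * (u ^ 3 - 2 * u)" using sx by (simp only: mult_cancel_right) simp
  obtain n1 n2 n3 :: nat where n: "dist Y Z = c * (n1 * dist Y Z + n2 * dist Z X + n3 * dist X Y)"
    "Suc 0 \<le> n2 + n3"
    using side_relation[OF Z] by blast
  \<comment> \<open>\<open>w\<close> turns out to be the scaling factor \<open>1 / c\<close>, whose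
    square is the number of tiles by \<open>ratio\<close>.\<close>
  define w where "w = real n1 + n2 * (u ^ 3 - 2 * u) + n3 * (u\<^sup>2 - 1)"
  have "dist Y Z * 1 = dist Y Z * (c * w)"
    using n(1) unfolding b_eq c_eq w_def by (simp add: algebra_simps)
  then have cw: "c * w = 1" using vertices_distinct by (simp only: mult_cancel_left) simp
  have "c\<^sup>2 * w\<^sup>2 = c\<^sup>2 * card \<T>"
    unfolding ratio using cw by (simp add: power_mult_distrib[symmetric])
  then have "w\<^sup>2 = real (card \<T>)" using ratio_pos by simp
  then have r: "(real n1 + n2 * ((2 * cos x) ^ 3 - 2 * (2 * cos x)) + n3 * ((2 * cos x)\<^sup>2 - 1))\<^sup>2
    = real (card \<T>)"
    by (simp only: w_def u_def)
  from x have "n2 = 0 \<and> n3 = 0"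
  proof
    assume "x = 2 * pi / 13"
    from r[unfolded this] show ?thesis by (rule no_side_relation_13)
  next
    assume "x = 2 * pi / 15"
    from r[unfolded this] show ?thesis by (rule no_side_relation_15)
  qed
  then show False using n(2) by simp
qed

section \<open>Splitting a vertex\<close>


lemma no_multiple_split:
  assumes acute: "y < pi / 2" "z < pi / 2" and k: "k \<ge> 3"
    and Z: "nX Z = k" "nY Z = 0" "nZ Z = 0"
  shows False
proof -
  have zk: "z = k * x" using corner_counts(1)[of Z] Z vertices_distinct by simp
  have yk: "y = pi - (k + 1) * x" using angles_sum zk by (simp add: algebra_simps)
  define s where "s = pi / x"
  have sx: "s * x = pi" using angles_pos by (simp add: s_def)
  \<comment> \<open>The lower bound is \<open>z < pi / 2\<close>, the upper one is
    \<open>y < pi / 2\<close>.\<close>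
  have s: "2 * k < s" "s < 2 * k + 2"
    using acute angles_pos unfolding zk yk s_def by (simp_all add: field_simps)
  have xz: "3 * x \<le> z" unfolding zk using k angles_pos by (intro mult_right_mono) auto
  \<comment> \<open>From \<open>3 * x <= z\<close> and \<open>z < pi / 2\<close> follow
    \<open>x < pi / 6\<close> and \<open>y > pi / 3\<close>.\<close>
  then have xy: "x < y" using acute angles_sum angles_pos by linarith
  have eq: "a + b * (s - (k + 1)) + c * k = m" if "a * x + b * y + c * z = m * x" for a b c m :: real
  proof -
    have "(a + b * (s - (k + 1)) + c * k) * x = m * x"
      using that sx unfolding zk yk by (simp add: algebra_simps)
    then show ?thesis using angles_pos by simp
  qed
  have inner: "\<exists>M::nat. M \<le> 2 \<and> nX P + nY P * (s - (k + 1)) + nZ P * real k = M * s" if P: "P \<notin> {X, Y, Z}" for P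
  proof -
    obtain M :: nat where "M \<le> 2" "nX P * x + nY P * y + nZ P * z = M * pi"
      using inner_counts[OF P] by blast
    then show ?thesis using eq[of "nX P" "nY P" "nZ P" "M * s"] sx by (auto simp: mult.assoc)
  qed
  have atX: "nX X = 1 \<and> nY X = 0 \<and> nZ X = 0"
  proof -
    have e: "nX X * x + nY X * y + nZ X * z = x" using corner_counts(1)[of X] by simp
    have nn: "0 \<le> nX X * x" "0 \<le> nY X * y" "0 \<le> nZ X * z" using angles_pos by auto
    have "nY X = 0"
    proof (rule ccontr)
      assume "nY X \<noteq> 0"
      then have "1 * y \<le> nY X * y" using angles_pos by (intro mult_right_mono) auto
      then show False using e nn xy by linarith
    qed
    moreover have "nZ X = 0"
    proof (rule ccontr)
      assume "nZ X \<noteq> 0"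
      then have "1 * z \<le> nZ X * z" using angles_pos by (intro mult_right_mono) auto
      then show False using e nn xz angles_pos by linarith
    qed
    ultimately show ?thesis using e angles_pos by simp
  qed
  have eY: "nX Y * x + nY Y * y + nZ Y * z = y" using corner_counts(1)[of Y] vertices_distinct by auto
  have eY': "nX Y + nY Y * (s - (k + 1)) + nZ Y * real k = s - (k + 1)"
  proof -
    have "y = (s - (k + 1)) * x" using sx yk by (simp add: algebra_simps)
    with eY have "nX Y * x + nY Y * y + nZ Y * z = (s - (k + 1)) * x" by simp
    from eq[OF this] show ?thesis .
  qed
  \<comment> \<open>Without an angle \<open>y\<close> at \<open>Y\<close>, \<open>s\<close> would be
    an integer strictly between \<open>2 * k\<close> and \<open>2 * k + 2\<close>.\<close>
  have atY: "nX Y = 0 \<and> nY Y = 1 \<and> nZ Y = 0" if "s \<noteq> 2 * k + 1"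
  proof (cases "nY Y = 0")
    case True
    then have "s = real (nX Y + nZ Y * k + k + 1)" using eY' by simp
    moreover from this have "2 * k < nX Y + nZ Y * k + k + 1" "nX Y + nZ Y * k + k + 1 < 2 * k + 2"
      using s by linarith+
    then have "nX Y + nZ Y * k + k + 1 = 2 * k + 1" by linarith
    ultimately have "s = real (2 * k + 1)" by (simp only:)
    then show ?thesis using that by simp
  next
    case False
    then have ge: "y \<le> nY Y * y" using angles_pos by (cases "nY Y") (auto simp: algebra_simps)
    have nn: "0 \<le> nX Y * x" "0 \<le> nZ Y * z" using angles_pos by auto
    have "nX Y * x = 0" "nZ Y * z = 0" "nY Y * y = y" using ge nn eY by linarith+
    then show ?thesis using angles_pos by auto
  qed
  \<comment> \<open>The bounds of \<open>vertex_counts_quarter\<close> require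
    \<open>k >= 4\<close>; for \<open>k = 3\<close> the two half-integral values of \<open>s\<close>
    are left to the argument with edge lengths.\<close>
  consider "s = 2 * k + 1" | "2 * s = 4 * k + 1" "k \<ge> 4" | "2 * s = 4 * k + 3" "k \<ge> 4"
    | "k = 3" "2 * s = 13 \<or> 2 * s = 15"
    | "s \<noteq> 2 * k + 1" "2 * s \<noteq> 4 * k + 1" "2 * s \<noteq> 4 * k + 3"
    using k by (cases "k = 3") auto
  then show False
  proof cases
    case 1
    \<comment> \<open>Under these weights \<open>X\<close> contributes 2, \<open>Z\<close>
      contributes \<open>2 * k\<close>, and \<open>Y\<close> at least -1, since at most one angle
      \<open>y\<close> or \<open>z\<close> fits there.\<close>
    have "2 * int (nX P) + -1 * int (nY P) + -1 * int (nZ P) \<ge> 0" if P: "P \<notin> {X, Y, Z}" for P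
    proof -
      obtain M :: nat where M: "M \<le> 2" "nX P + nY P * (s - (k + 1)) + nZ P * real k = M * s"
        using inner[OF P] by blast
      have "real (nX P + (nY P + nZ P) * k) = real (M * (2 * k + 1))"
        using M(2) unfolding 1 by (simp add: algebra_simps)
      then have "nX P + (nY P + nZ P) * k = M * (2 * k + 1)" by (simp only: of_nat_eq_iff)
      from vertex_counts_isosceles[OF k M(1) this] show ?thesis by simp
    qed
    from no_positive_weight[OF _ this] have le: "2 * int (nX Y) - nY Y - nZ Y + 2 + 2 * k \<le> 0"
      using atX Z by simp
    have "real (nX Y + (nY Y + nZ Y) * k) = real k" using eY' unfolding 1 by (simp add: algebra_simps)
    then have "nX Y + (nY Y + nZ Y) * k = k" by (simp only: of_nat_eq_iff)
    then have "(nY Y + nZ Y) * k \<le> 1 * k" by linarith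
    then have "nY Y + nZ Y \<le> 1" using k by (simp only: mult_le_cancel2)
    then show False using le k by linarith
  next
    case 2
    then have sk: "s = 2 * k + 1 / 2" by simp
    \<comment> \<open>The corners \<open>X\<close>, \<open>Y\<close>, \<open>Z\<close> contribute 4,
      -3 and \<open>4 * k\<close>, a positive total.\<close>
    have "4 * int (nX P) + -3 * int (nY P) + -1 * int (nZ P) \<ge> 0" if P: "P \<notin> {X, Y, Z}" for P
    proof -
      obtain M :: nat where M: "M \<le> 2" "nX P + nY P * (s - (k + 1)) + nZ P * real k = M * s"
        using inner[OF P] by blast
      have "real (2 * nX P + 2 * k * nY P + 2 * k * nZ P) = real (M * (4 * k + 1) + nY P)"
        using M(2) unfolding sk by (simp add: algebra_simps)
      then have "2 * nX P + 2 * k * nY P + 2 * k * nZ P = M * (4 * k + 1) + nY P" by (simp only: of_nat_eq_iff)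
      from vertex_counts_quarter(1)[OF 2(2) M(1) this] show ?thesis by simp
    qed
    from no_positive_weight[OF _ this] show False using atX atY Z 2 by simp
  next
    case 3
    then have sk: "s = 2 * k + 3 / 2" by simp
    have "4 * int (nX P) + -1 * int (nY P) + -3 * int (nZ P) \<ge> 0" if P: "P \<notin> {X, Y, Z}" for P
    proof -
      obtain M :: nat where M: "M \<le> 2" "nX P + nY P * (s - (k + 1)) + nZ P * real k = M * s"
        using inner[OF P] by blast
      have "real (2 * nX P + 2 * k * nY P + nY P + 2 * k * nZ P) = real (M * (4 * k + 3))"
        using M(2) unfolding sk by (simp add: algebra_simps)
      then have "2 * nX P + 2 * k * nY P + nY P + 2 * k * nZ P = M * (4 * k + 3)" by (simp only: of_nat_eq_iff)
      from vertex_counts_quarter(2)[OF 3(2) M(1) this] show ?thesis by simp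
    qed
    from no_positive_weight[OF _ this] show False using atX atY Z 3 by simp
  next
    case 4
    have "fX S = Z" if "S \<in> \<T>" "Z \<in> S" for S
    proof -
      have "fY S \<noteq> Z" "fZ S \<noteq> Z" using Z(2,3) finite_tiles that(1) by (auto simp: nY_def nZ_def)
      then show ?thesis using corner_counts(2)[of Z S] that by auto
    qed
    moreover have "z = 3 * x" using zk 4 by simp
    moreover have "x = 2 * pi / 13 \<or> x = 2 * pi / 15"
    proof -
      have "s = 13 / 2 \<or> s = 15 / 2" using 4(2) by auto
      moreover have "x = pi / s" using angles_pos by (simp add: s_def)
      moreover have "pi / (13 / 2) = 2 * pi / 13" "pi / (15 / 2) = 2 * pi / 15" by simp_all
      ultimately show ?thesis by metis
    qed
    ultimately show False by (rule no_exceptional_split)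
  next
    case 5
    \<comment> \<open>Among the corners only \<open>Y\<close> counts, with weight 1.\<close>
    have "0 * int (nX P) + 1 * int (nY P) + -1 * int (nZ P) \<ge> 0" if P: "P \<notin> {X, Y, Z}" for P
    proof -
      obtain M :: nat where M: "M \<le> 2" "nX P + nY P * (s - (k + 1)) + nZ P * real k = M * s"
        using inner[OF P] by blast
      then have "nX P + nY P * (s - (k + 1)) + nZ P * k = M * s" by simp
      from vertex_counts_dominance[OF k s M(1) this] show ?thesis using 5 by simp
    qed
    from no_positive_weight[OF _ this] show False using atX atY Z 5 by simp
  qed
qed

text \<open>Exchanging \<open>X\<close> and \<open>Y\<close> lets \<open>no_multiple_split\<close>
  also treat a corner \<open>Z\<close> filled with angles \<open>y\<close>.\<close>

lemma swap: "similar_tiling Y X Z \<T> c fY fX fZ"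
proof
  show "cross2 (X - Y) (Z - Y) \<noteq> 0" using D'(1) cross2_swap[of "Z - Y"] by simp
  show "\<Union>\<T> = convex hull {Y, X, Z}" using Union_tiles by (simp add: insert_commute)
  show "finite \<T>" "pairwise (\<lambda>S S'. interior S \<inter> interior S' = {}) \<T>" "c > 0" "c\<^sup>2 * card \<T> = 1"
    by (rule finite_tiles disjoint_interiors ratio_pos ratio)+
  fix S assume S: "S \<in> \<T>"
  show "S = convex hull {fY S, fX S, fZ S}" using tile[OF S] by (simp add: insert_commute)
  show "dist (fY S) (fX S) = c * dist Y X" "dist (fX S) (fZ S) = c * dist X Z" "dist (fY S) (fZ S) = c * dist Y Z"
    using tile_dist[OF S] by (simp_all add: dist_commute)
qed

lemma few_tiles_at_corner:
  assumes acute: "x < pi / 2" "y < pi / 2" "z < pi / 2"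
  shows "card {S \<in> \<T>. Z \<in> S} < 3"
proof (rule ccontr)
  assume many: "\<not> ?thesis"
  define k where "k = card {S \<in> \<T>. Z \<in> S}"
  have k: "k \<ge> 3" using many by (simp add: k_def)
  have cnt: "nX Z + nY Z + nZ Z = k"
    unfolding k_def by (rule count_card[symmetric]) (use corner_counts(2)[of Z] in blast)
  have e: "nX Z * x + nY Z * y + nZ Z * z = z" using corner_counts(1)[of Z] vertices_distinct by auto
  have nn: "0 \<le> nX Z * x" "0 \<le> nY Z * y" "0 \<le> nZ Z * z" using angles_pos by auto
  \<comment> \<open>A single angle \<open>z\<close> would fill the corner alone, but at least three
    tiles meet there.\<close>
  have nZ: "nZ Z = 0"
  proof (rule ccontr)
    assume "nZ Z \<noteq> 0"
    then have "1 * z \<le> nZ Z * z" using angles_pos by (intro mult_right_mono) auto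
    then have "nX Z * x = 0" "nY Z * y = 0" "nZ Z * z = z" using e nn by linarith+
    then show False using angles_pos cnt k by auto
  qed
  \<comment> \<open>Both kinds together would give \<open>z >= x + y\<close>, that is,
    \<open>z >= pi / 2\<close>.\<close>
  have "nX Z = 0 \<or> nY Z = 0"
  proof (rule ccontr)
    assume "\<not> ?thesis"
    then have "1 * x \<le> nX Z * x" "1 * y \<le> nY Z * y" using angles_pos by (auto intro!: mult_right_mono)
    then have "x + y \<le> z" using e nn by linarith
    then show False using angles_sum acute by linarith
  qed
  then show False
  proof
    assume "nY Z = 0"
    then show False using no_multiple_split[OF acute(2,3) k] cnt nZ by simp
  next
    assume "nX Z = 0"
    interpret swap: similar_tiling Y X Z \<T> c fY fX fZ by (rule swap)
    have "swap.y = x" "swap.z = z"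
      unfolding swap.y_def swap.z_def x_def z_def by (simp_all add: angle_at_def inner_commute mult.commute)
    then show False
      using swap.no_multiple_split[OF _ _ k] acute cnt nZ \<open>nX Z = 0\<close>
      by (simp add: swap.nX_def swap.nY_def swap.nZ_def nX_def nY_def nZ_def)
  qed
qed

end

section \<open>From a reptiling to a labelled tiling with a common ratio\<close>

lemma similarity_hull:
  fixes f :: "real^2 \<Rightarrow> real^2"
  assumes "\<And>p q. dist (f p) (f q) = c * dist p q"
  shows "f ` (convex hull {P, Q, R}) = convex hull {f P, f Q, f R}"
proof -
  define L where "L p = f p - f 0" for p
  have "L 0 = 0" by (simp add: L_def)
  moreover have "\<forall>p q. dist (L p) (L q) = c * dist p q" using assms by (simp add: L_def dist_norm)
  \<comment> \<open>A map that scales distances and fixes the origin is linear, so \<open>f\<close>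
    is affine and maps hulls to hulls.\<close>
  ultimately have L: "linear L" by (rule scaling_linear)
  have f: "f ` A = (+) (f 0) ` (L ` A)" for A by (simp add: L_def image_image)
  have "f ` (convex hull {P, Q, R}) = convex hull ((+) (f 0) ` (L ` {P, Q, R}))"
    unfolding f by (simp only: convex_hull_linear_image[OF L] convex_hull_translation)
  then show ?thesis unfolding f[symmetric] by simp
qed

text \<open>The radicand in Heron's formula is homogeneous of degree four in the side
  lengths.\<close>

lemma content_similar:
  fixes P Q R P' Q' R' :: "real^2"
  assumes "c \<ge> 0" "dist P' Q' = c * dist P Q" "dist P' R' = c * dist P R" "dist Q' R' = c * dist Q R"
  shows "measure lborel (convex hull {P', Q', R'}) = c\<^sup>2 * measure lborel (convex hull {P, Q, R})"
proof -
  define a b d where "a = dist Q R" and "b = dist P R" and "d = dist P Q"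
  define s where "s = (a + b + d) / 2"
  have s: "(c * a + c * b + c * d) / 2 = c * s" by (simp add: s_def algebra_simps)
  have "measure lborel (convex hull {P', Q', R'}) = sqrt (c * s * (c * s - c * a) * (c * s - c * b) * (c * s - c * d))"
    by (subst heron) (simp only: assms(2-4) a_def[symmetric] b_def[symmetric] d_def[symmetric] s)
  also have "\<dots> = sqrt ((c\<^sup>2)\<^sup>2 * (s * (s - a) * (s - b) * (s - d)))"
    by (rule arg_cong[where f = sqrt]) (simp add: power2_eq_square algebra_simps)
  also have "\<dots> = c\<^sup>2 * sqrt (s * (s - a) * (s - b) * (s - d))"
    by (simp only: real_sqrt_mult real_sqrt_abs abs_power2)
  finally show ?thesis unfolding heron a_def[symmetric] b_def[symmetric] d_def[symmetric] s_def[symmetric] .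
qed

text \<open>A vanishing cross product is the equality case of the Cauchy-Schwarz inequality, which
  means collinearity.\<close>

lemma cross2_nonzero:
  assumes "\<not> affine_dependent {X, Y, Z}" "X \<noteq> Y" "Y \<noteq> Z" "X \<noteq> Z"
  shows "cross2 (Y - X) (Z - X) \<noteq> 0"
proof
  assume "cross2 (Y - X) (Z - X) = 0"
  then have "((Y - X) \<bullet> (Z - X))\<^sup>2 = (norm (Y - X) * norm (Z - X))\<^sup>2"
    using cross2_square[of "Y - X" "Z - X"] by (simp add: power_mult_distrib)
  then have "\<bar>(Y - X) \<bullet> (Z - X)\<bar> = norm (Y - X) * norm (Z - X)"
    unfolding power2_eq_iff by (elim disjE) simp_all
  then have "collinear {0, Y - X, Z - X}" by (simp add: norm_cauchy_schwarz_equal)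
  then have "collinear {Y, X, Z}" by (subst collinear_3) simp
  then show False using assms by (simp add: collinear_3_eq_affine_dependent insert_commute)
qed

lemma content_Union_tiles:
  fixes \<T> :: "(real^2) set set"
  assumes "finite \<T>" "\<And>S. S \<in> \<T> \<Longrightarrow> compact S" "\<And>S. S \<in> \<T> \<Longrightarrow> convex S"
    and "pairwise (\<lambda>S S'. interior S \<inter> interior S' = {}) \<T>"
  shows "measure lborel (\<Union>\<T>) = (\<Sum>S\<in>\<T>. measure lborel S)"
proof -
  have m: "measure lebesgue S = measure lborel S" if "compact S" for S :: "(real^2) set"
    using that by (intro measure_completion) (auto dest: compact_imp_closed)
  have "measure lebesgue (\<Union>\<T>) = (\<Sum>S\<in>\<T>. measure lebesgue S)"
  proof (rule measure_negligible_finite_Union[OF assms(1)])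
    show "pairwise (\<lambda>S S'. negligible (S \<inter> S')) \<T>"
    proof (rule pairwiseI)
      fix S S' assume "S \<in> \<T>" "S' \<in> \<T>" "S \<noteq> S'"
      then have "convex (S \<inter> S')" "interior (S \<inter> S') = {}"
        using assms(3,4) by (auto simp: pairwise_def intro: convex_Int)
      then show "negligible (S \<inter> S')" by (simp add: negligible_convex_interior)
    qed
  qed (use assms lmeasurable_compact in auto)
  moreover have "compact (\<Union>\<T>)" using assms(1,2) by (simp add: compact_Union)
  ultimately show ?thesis using m assms(2) by (simp cong: sum.cong)
qed

text \<open>The extreme points \<open>X\<close>, \<open>Y\<close>, \<open>Z\<close> must be images
  of the three tile vertices, and their preimages give the labels. The similarity maps the tile to
  the large triangle, so the ratio is the inverse of its factor.\<close>

lemma tile_labelling: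
  fixes X Y Z :: "real^2"
  assumes ind: "\<not> affine_dependent {X, Y, Z}" and ne: "X \<noteq> Y" "Y \<noteq> Z" "X \<noteq> Z"
    and S: "2 simplex S" and sim: "similar_sets S (convex hull {X, Y, Z})"
  shows "\<exists>c A B C. c > 0 \<and> S = convex hull {A, B, C} \<and> dist A B = c * dist X Y \<and>
    dist B C = c * dist Y Z \<and> dist A C = c * dist X Z"
proof -
  obtain d f where d: "d > 0" and f: "\<And>p q. dist (f p) (f q) = d * dist p q"
    and img: "f ` S = convex hull {X, Y, Z}"
    using sim unfolding similar_sets_def by blast
  obtain K where K: "card K = 3" "S = convex hull K" using S unfolding simplex_def by auto
  obtain P Q R where PQR: "K = {P, Q, R}" "P \<noteq> Q" "Q \<noteq> R" "P \<noteq> R" using K(1) by (metis card_3_iff)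
  have "convex hull {X, Y, Z} = convex hull {f P, f Q, f R}"
    using similarity_hull[of f d P Q R] f img K PQR by simp
  then have sub: "{X, Y, Z} \<subseteq> {f P, f Q, f R}"
    using extreme_point_of_convex_hull_affine_independent[OF ind] extreme_point_of_convex_hull by fastforce
  have pre: "\<exists>A\<in>{P, Q, R}. f A = p" if "p \<in> {X, Y, Z}" for p
    using subsetD[OF sub that] by auto
  obtain A where A: "A \<in> {P, Q, R}" "f A = X" using pre[of X] by blast
  obtain B where B: "B \<in> {P, Q, R}" "f B = Y" using pre[of Y] by blast
  obtain C where C: "C \<in> {P, Q, R}" "f C = Z" using pre[of Z] by blast
  have "A \<noteq> B" "B \<noteq> C" "A \<noteq> C" using A(2) B(2) C(2) ne by auto
  then have "{A, B, C} = {P, Q, R}" using A(1) B(1) C(1) by auto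
  then have "S = convex hull {A, B, C}" using K PQR by simp
  moreover have "dist p q = (1 / d) * dist (f p) (f q)" for p q using d f by simp
  then have "dist A B = (1 / d) * dist X Y" "dist B C = (1 / d) * dist Y Z" "dist A C = (1 / d) * dist X Z"
    unfolding A(2)[symmetric] B(2)[symmetric] C(2)[symmetric] by blast+
  moreover have "1 / d > 0" using d by simp
  ultimately show ?thesis by blast
qed

theorem theorem9:
  fixes T :: "(real^2) set" and k :: nat
  assumes "acute_triangle T" and "k \<ge> 3"
  shows "\<not> (\<exists>\<T>. splitting_reptiling k T \<T>)"
proof
  assume "\<exists>\<T>. splitting_reptiling k T \<T>"
  then obtain \<T> r v where r: "reptiling r T \<T>" and v: "v extreme_point_of T" "card {S \<in> \<T>. v \<in> S} = k"
    unfolding splitting_reptiling_def by blast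
  obtain K where K: "\<not> affine_dependent K" "card K = 3" "T = convex hull K"
    using assms(1) unfolding acute_triangle_def simplex_def by auto
  have ext: "p extreme_point_of T \<longleftrightarrow> p \<in> K" for p
    unfolding K(3) by (rule extreme_point_of_convex_hull_affine_independent[OF K(1)])
  have "v \<in> K" using v ext by simp
  then have "card (K - {v}) = 2" using K(2) by simp
  then obtain X Y where XY: "K - {v} = {X, Y}" "X \<noteq> Y" by (auto simp: card_2_iff)
  define Z where "Z = v"
  have KXYZ: "K = {X, Y, Z}" using XY \<open>v \<in> K\<close> by (auto simp: Z_def)
  have ne: "X \<noteq> Y" "Y \<noteq> Z" "X \<noteq> Z" using XY by (auto simp: Z_def)
  note ind = K(1)[unfolded KXYZ] and T = K(3)[unfolded KXYZ]
  have D: "cross2 (Y - X) (Z - X) \<noteq> 0" using cross2_nonzero[OF ind ne] .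
  have tiles: "r \<ge> 2" "finite \<T>" "card \<T> = r" "\<And>S. S \<in> \<T> \<Longrightarrow> 2 simplex S" "\<Union>\<T> = T"
    "pairwise (\<lambda>S S'. interior S \<inter> interior S' = {}) \<T>"
    "\<And>S. S \<in> \<T> \<Longrightarrow> similar_sets S T"
    "\<And>S S'. S \<in> \<T> \<Longrightarrow> S' \<in> \<T> \<Longrightarrow> congruent_sets S S'"
    using r unfolding reptiling_def by auto
  define R where "R S c A B C \<longleftrightarrow> c > 0 \<and> S = convex hull {A, B, C} \<and> dist A B = c * dist X Y \<and>
    dist B C = c * dist Y Z \<and> dist A C = c * dist X Z" for S :: "(real^2) set" and c A B C
  have "\<forall>S\<in>\<T>. \<exists>c A B C. R S c A B C"
    unfolding R_def using tile_labelling[OF ind ne] tiles(4,7) unfolding T by blast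
  then obtain cS fX fY fZ where lab: "\<And>S. S \<in> \<T> \<Longrightarrow> R S (cS S) (fX S) (fY S) (fZ S)" by metis
  have area: "measure lborel S = (cS S)\<^sup>2 * measure lborel T" if "S \<in> \<T>" for S
    using lab[OF that] content_similar[of "cS S" "fX S" "fY S" X Y "fZ S" Z] unfolding R_def T by simp
  have "measure lborel T = \<bar>cross2 (Y - X) (Z - X)\<bar> / 2"
    unfolding T content_triangle cross2_def by (simp add: mult.commute abs_minus_commute)
  then have Tpos: "measure lborel T > 0" using D by simp
  \<comment> \<open>Congruent tiles have equal areas, and the area of a tile determines its
    ratio.\<close>
  have c_eq: "cS S = cS S'" if SS: "S \<in> \<T>" "S' \<in> \<T>" for S S'
  proof -
    obtain g where g: "\<And>p q. dist (g p) (g q) = dist p q" "g ` S = S'"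
      using tiles(8)[OF SS] unfolding congruent_sets_def by blast
    have hull: "S = convex hull {fX S, fY S, fZ S}" using lab[OF SS(1)] unfolding R_def by blast
    have "S' = convex hull {g (fX S), g (fY S), g (fZ S)}"
      using similarity_hull[of g 1] g hull by (metis mult_1)
    then have "measure lborel S' = measure lborel S"
      using content_similar[of 1 "g (fX S)" "g (fY S)" "fX S" "fY S" "g (fZ S)" "fZ S"] g(1) hull by simp
    then have "(cS S')\<^sup>2 = (cS S)\<^sup>2" using area SS Tpos by simp
    then show ?thesis using lab SS unfolding R_def by (simp add: power2_eq_iff_nonneg less_imp_le)
  qed
  have "\<T> \<noteq> {}" using tiles(1,3) by auto
  then obtain S0 where S0: "S0 \<in> \<T>" by blast
  define c where "c = cS S0"
  have lab': "R S c (fX S) (fY S) (fZ S)" if "S \<in> \<T>" for S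
    using lab[OF that] c_eq[OF that S0] by (simp add: c_def)
  \<comment> \<open>Adding the areas of the tiles shows that their number is the inverse square of
    the ratio.\<close>
  have "measure lborel T = (\<Sum>S\<in>\<T>. measure lborel S)"
    unfolding tiles(5)[symmetric] using tiles(2,4,6)
    by (intro content_Union_tiles) (auto intro: compact_simplex convex_simplex)
  also have "\<dots> = (\<Sum>S\<in>\<T>. c\<^sup>2 * measure lborel T)"
  proof (rule sum.cong[OF refl])
    fix S assume S: "S \<in> \<T>"
    show "measure lborel S = c\<^sup>2 * measure lborel T" unfolding area[OF S] c_def c_eq[OF S S0] ..
  qed
  finally have "measure lborel T = (c\<^sup>2 * card \<T>) * measure lborel T" by (simp add: mult.commute)
  then have ratio: "c\<^sup>2 * card \<T> = 1" using Tpos by simp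
  interpret similar_tiling X Y Z \<T> c fX fY fZ
  proof
    show "\<Union>\<T> = convex hull {X, Y, Z}" using tiles(5) T by simp
    show "c > 0" using lab'[OF S0] unfolding R_def by blast
    fix S assume "S \<in> \<T>"
    from lab'[OF this] show "S = convex hull {fX S, fY S, fZ S}" "dist (fX S) (fY S) = c * dist X Y"
      "dist (fY S) (fZ S) = c * dist Y Z" "dist (fX S) (fZ S) = c * dist X Z"
      unfolding R_def by blast+
  qed (rule D tiles(2) tiles(6) ratio)+
  have "angle_at a b d < pi / 2" if "{a, b, d} = {X, Y, Z}" "a \<noteq> b" "b \<noteq> d" "a \<noteq> d" for a b d
    using assms(1) that ext unfolding acute_triangle_def KXYZ by blast
  then have "x < pi / 2" "y < pi / 2" "z < pi / 2"
    unfolding x_def y_def z_def using ne by (auto simp: insert_commute)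
  from few_tiles_at_corner[OF this] v(2) assms(2) show False by (simp add: Z_def)
qed

end
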